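(* For all real $k$ and all $0<a,b<1$, $$\int_a^b\left(\frac{f(-q^5)}{f(-q)}\right)^{-6k+5} f(-q)^4\,q^{-k}\,dq=-\int_{u(a)}^{u(b)}\frac{x^{k-1}}{\sqrt{125+22x+x^2}}\,dx,$$ where $u(q)=\frac{1}{R(q)^5}-11-R(q)^5$.
   Context: For $0<q<1$, $f(-q)=\prod_{n\ge1}(1-q^n)$ and $R(q)$ is the Rogers–Ramanujan continued fraction $R(q)=\dfrac{q^{1/5}}{1+\dfrac{q}{1+\dfrac{q^2}{1+\dfrac{q^3}{1+\cdots}}}}$ (positive real fifth root). Real powers of positive quantities are the positive real ones. *)

theory Defs
  imports "HOL-Analysis.Analysis"
begin

text \<open>Ramanujan's function, with his sign convention
  \<open>f(-q) = (1 - q)(1 - q^2)(1 - q^3)\<dots>\<close>.\<close>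

definition ramanujan_f :: "real \<Rightarrow> real" where
  "ramanujan_f x = (\<Prod>n. 1 - (- x) ^ Suc n)"

text \<open>\<open>rr_denom q m n\<close> is the finite continued fraction
  \<open>1 + q^m / (1 + q^(m+1) / (1 + \<dots> / (1 + q^(m+n-1))))\<close> with \<open>n\<close> partial quotients.\<close>

fun rr_denom :: "real \<Rightarrow> nat \<Rightarrow> nat \<Rightarrow> real" where
  "rr_denom q m 0 = 1"
| "rr_denom q m (Suc n) = 1 + q ^ m / rr_denom q (Suc m) n"

text \<open>As usual, the value of the infinite continued fraction is the limit of its convergents.\<close>

definition rr_cfrac :: "real \<Rightarrow> real" where
  "rr_cfrac q = lim (\<lambda>n. root 5 q / rr_denom q 1 n)"

definition rr_u :: "real \<Rightarrow> real" where
  "rr_u q = 1 / rr_cfrac q ^ 5 - 11 - rr_cfrac q ^ 5"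

end

theory Submission
  imports Defs "HOL-Library.Nat_Bijection"
begin

text \<open>
  Write \<open>f(-q)\<close> as \<open>f\<close>, \<open>f(-q\<^sup>5)\<close> as \<open>g\<close>, and \<open>R\<close> for the continued fraction. Since
  \<open>125 + 22 u + u\<^sup>2 = (u + 11)\<^sup>2 + 4 = (1 / R\<^sup>5 + R\<^sup>5)\<^sup>2\<close>, the substitution \<open>x = u(q)\<close> reduces the theorem to
  \<open>u = f\<^sup>6 / (q g\<^sup>6)\<close> and \<open>q R' / R = f\<^sup>5 / (5 g)\<close>.

  Rogers' recurrences give \<open>R = q\<^bsup>1/5\<^esup> \<alpha> / \<beta>\<close>, where \<open>\<alpha>\<close> and \<open>\<beta>\<close> are the alternating theta series with
  exponents \<open>n (5 n - 3) / 2\<close> and \<open>n (5 n - 1) / 2\<close>; by the triple product, \<open>\<alpha> \<beta> = f g\<close>.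

  For the first identity, split the pentagonal number series of \<open>f(-x)\<close> by the residue of the summation
  index modulo 5. With \<open>x\<^sup>5 = q\<close> and the quintuple product this gives
  \<open>f(-x) = g (\<beta> / \<alpha> - x - x\<^sup>2 \<alpha> / \<beta>)\<close>. Multiplying over the five fifth roots \<open>x\<close> of \<open>q\<close> yields \<open>f\<^sup>6 / g\<close> on the left
  and \<open>q g\<^sup>5 (1 / R\<^sup>5 - 11 - R\<^sup>5)\<close> on the right.

  For the second identity, the Wronskian of \<open>q\<^bsup>9/40\<^esup> \<alpha>\<close> and \<open>q\<^bsup>1/40\<^esup> \<beta>\<close> is a double theta series, which a
  rotation of the Gaussian integers by \<open>2 + \<i>\<close> turns into the square of Jacobi's series for \<open>f\<^sup>3\<close>.
\<close>

subsection \<open>Absolutely convergent series over the integers\<close>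

text \<open>The constant 11 is the fifth Lucas number: \<open>1 - x - x^2\<close> splits over the
  golden ratio and its conjugate, and a product over the fifth roots of unity replaces these two
  numbers by their fifth powers, of sum 11 and product -1. The prefactors with exponents 9/40 and
  1/40 complete the square: every exponent becomes an odd square over 40, so \<open>q d/dq\<close>
  only multiplies the terms by squares. Under the rotation, the difference of two such squares
  becomes a form with opposite coefficients at \<open>s^2\<close> and \<open>t^2\<close>; these
  cancel in the double sum by symmetry, and the mixed term that survives is a square of a single
  series. The continued fraction is given as a limit of convergents, so its convergence has to be
  proved along with its value; this is why Rogers' functions are followed for all \<open>m\<close>
  up to their limit. The basic infinite identities come from finite ones by dominated convergence,
  and absolute summability justifies the later rearrangements.\<close>

lemma infsum_int_decode: "(\<Sum>\<^sub>\<infinity>n. f n) = (\<Sum>\<^sub>\<infinity>k. f (int_decode k))"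
  using infsum_reindex_bij_betw[OF bij_int_decode] by metis

lemma summable_on_int_decode:
  "f summable_on UNIV \<longleftrightarrow> (\<lambda>k. f (int_decode k)) summable_on UNIV"
  using summable_on_reindex_bij_betw[OF bij_int_decode] by metis

text \<open>Unconditional convergence makes the enumeration of the integers irrelevant. This gives
  access to the theorems on ordinary series: Tannery's theorem and termwise differentiation.\<close>

lemma infsum_int_suminf:
  fixes f :: "int \<Rightarrow> 'a :: banach"
  assumes "f summable_on UNIV"
  shows "(\<Sum>\<^sub>\<infinity>n. f n) = (\<Sum>k. f (int_decode k))"
proof -
  have "(\<lambda>k. f (int_decode k)) summable_on UNIV"
    using assms summable_on_int_decode by blast
  then have "((\<lambda>k. f (int_decode k)) has_sum (\<Sum>\<^sub>\<infinity>k. f (int_decode k))) UNIV"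
    by (rule has_sum_infsum)
  from has_sum_imp_sums[OF this] show ?thesis
    by (simp add: infsum_int_decode sums_iff)
qed

text \<open>Dominated convergence for bilateral series. It carries the finite triple product to the
  infinite one.\<close>

lemma tannery_int:
  fixes a :: "int \<Rightarrow> nat \<Rightarrow> 'a :: {real_normed_field, banach}"
  assumes lim: "\<And>k. (\<lambda>n. a k n) \<longlonglongrightarrow> b k"
    and bound: "\<And>k n. norm (a k n) \<le> M k"
    and M: "M summable_on UNIV"
  shows "(\<lambda>n. \<Sum>\<^sub>\<infinity>k. a k n) \<longlonglongrightarrow> (\<Sum>\<^sub>\<infinity>k. b k)"
proof -
  have M0: "M k \<ge> 0" for k
    using bound[of k 0] norm_ge_zero order_trans by blast
  have sM: "summable (\<lambda>k. M (int_decode k))"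
    using M summable_on_int_decode summable_on_imp_summable by blast
  have bb: "norm (b k) \<le> M k" for k
    by (rule LIMSEQ_le_const2[OF tendsto_norm[OF lim]]) (use bound in auto)
  have eq: "(\<Sum>\<^sub>\<infinity>k. c k) = (\<Sum>k. c (int_decode k))" if "\<And>k. norm (c k) \<le> M k" for c :: "int \<Rightarrow> 'a"
    by (rule infsum_int_suminf[OF abs_summable_summable[OF Infinite_Sum.abs_summable_on_comparison_test'[OF M that]]])
  have "(\<lambda>n. \<Sum>k. a (int_decode k) n) \<longlonglongrightarrow> (\<Sum>k. b (int_decode k))"
    by (rule tannerys_theorem[THEN conjunct2, THEN conjunct2, OF _ _ sM])
      (use lim bound in \<open>auto intro!: always_eventually\<close>)
  then show ?thesis
    using eq[of "\<lambda>k. a k _"] eq[of b] bound bb by simp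
qed

text \<open>The negative half-line is parametrised by \<open>- n - 1\<close> so that 0 is not
  counted twice.\<close>

lemma summable_on_intI:
  fixes f :: "int \<Rightarrow> 'a :: real_normed_vector"
  assumes "(\<lambda>n. f (int n)) summable_on UNIV" "(\<lambda>n. f (- int n - 1)) summable_on UNIV"
  shows "f summable_on UNIV"
proof -
  have "f summable_on range int"
    using assms(1) by (subst summable_on_reindex) (auto simp: inj_on_def o_def)
  moreover have "f summable_on range (\<lambda>n. - int n - 1)"
    using assms(2) by (subst summable_on_reindex) (auto simp: inj_on_def o_def)
  moreover have "range int \<inter> range (\<lambda>n. - int n - 1) = {}"
    by auto
  moreover have "UNIV = range int \<union> range (\<lambda>n. - int n - 1)"
  proof -
    have "x \<in> range int \<union> range (\<lambda>n. - int n - 1)" for x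
    proof (cases "x \<ge> 0")
      case True
      then show ?thesis by (metis UnI1 nonneg_int_cases rangeI)
    next
      case False
      then have "x = - int (nat (- x - 1)) - 1" by auto
      then show ?thesis by blast
    qed
    then show ?thesis by blast
  qed
  ultimately show ?thesis
    using summable_on_Un_disjoint by metis
qed

text \<open>Termwise differentiation preserves convergence inside the unit disc and raises the
  degree of the weight by one, so induction starts from the geometric series. The case
  \<open>r = 0\<close> is separate because the index shift at the end divides by
  \<open>r\<close>.\<close>

lemma summable_poly_geometric:
  fixes r :: real
  assumes "0 \<le> r" "r < 1"
  shows "summable (\<lambda>n. real (Suc n) ^ k * r ^ n)"
proof (cases "r = 0")
  case True
  then show ?thesis
    by (intro summable_finite[of "{0}"]) auto
next
  case False
  have *: "\<forall>x::real. norm x < 1 \<longrightarrow> summable (\<lambda>n. real n ^ k * x ^ n)" for k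
  proof (induction k)
    case 0
    then show ?case by (auto simp: summable_geometric)
  next
    case (Suc k)
    show ?case
    proof (intro allI impI)
      fix x :: real assume x: "norm x < 1"
      have "summable (\<lambda>n. diffs (\<lambda>n. real n ^ k) n * x ^ n)"
        using termdiff_converges[of x 1 "\<lambda>n. real n ^ k"] x Suc by auto
      then have "summable (\<lambda>n. x * (real (Suc n) ^ Suc k * x ^ n))"
        by (intro summable_mult) (simp add: diffs_def)
      then have "summable (\<lambda>n. real (Suc n) ^ Suc k * x ^ Suc n)"
        by (simp add: algebra_simps)
      then show "summable (\<lambda>n. real n ^ Suc k * x ^ n)"
        by (subst (asm) summable_Suc_iff)
    qed
  qed
  have "summable (\<lambda>n. real (Suc n) ^ k * r ^ Suc n)"
    by (subst summable_Suc_iff) (use * assms in auto)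
  then have "summable (\<lambda>n. (1 / r) * (real (Suc n) ^ k * r ^ Suc n))"
    by (rule summable_mult)
  moreover have "(1 / r) * (real (Suc n) ^ k * r ^ Suc n) = real (Suc n) ^ k * r ^ n" for n
    using False by (simp add: field_simps)
  ultimately show ?thesis by (simp only:)
qed

text \<open>The common majorant of all theta series below, with or without polynomial
  weights.\<close>

lemma summable_on_int_poly_geometric:
  fixes r :: real
  assumes "0 \<le> r" "r < 1"
  shows "(\<lambda>n::int. C * (real_of_int (1 + \<bar>n\<bar>) ^ k * r ^ nat \<bar>n\<bar>)) summable_on UNIV"
proof (rule summable_on_cmult_right, rule summable_on_intI)
  have 1: "summable (\<lambda>n. (1 + real n) ^ k * r ^ n)"
    using summable_poly_geometric[OF assms, of k] by (simp add: add.commute)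
  then have 2: "summable (\<lambda>n. (2 + real n) ^ k * r ^ Suc n)"
    using 1 by (subst (asm) summable_Suc_iff[symmetric]) simp
  show "(\<lambda>n. real_of_int (1 + \<bar>int n\<bar>) ^ k * r ^ nat \<bar>int n\<bar>) summable_on UNIV"
    by (rule norm_summable_imp_summable_on) (use assms 1 in simp)
  have "nat \<bar>- int n - 1\<bar> = Suc n" for n by auto
  moreover have "real_of_int (1 + \<bar>- int n - 1\<bar>) = 2 + real n" for n by auto
  ultimately show "(\<lambda>n. real_of_int (1 + \<bar>- int n - 1\<bar>) ^ k * r ^ nat \<bar>- int n - 1\<bar>) summable_on UNIV"
    by (intro norm_summable_imp_summable_on) (use assms 2 in simp)
qed

abbreviation abs_summable :: "('b \<Rightarrow> 'a :: real_normed_vector) \<Rightarrow> bool" where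
  "abs_summable f \<equiv> (\<lambda>x. norm (f x)) summable_on UNIV"

lemma abs_summable_times:
  fixes f :: "'b \<Rightarrow> 'a :: {real_normed_field, banach}" and g :: "'c \<Rightarrow> 'a"
  assumes f: "abs_summable f" and g: "abs_summable g"
  shows "abs_summable (\<lambda>(x, y). f x * g y)"
proof -
  have "(\<lambda>x. norm (f x) * (\<Sum>\<^sub>\<infinity>y. norm (g y))) summable_on UNIV"
    by (rule summable_on_cmult_left[OF f])
  moreover have "(\<lambda>y. norm (f x) * norm (g y)) summable_on UNIV" for x
    by (rule summable_on_cmult_right[OF g])
  ultimately show ?thesis
    using Infinite_Sum.abs_summable_on_Sigma_iff[of "\<lambda>(x, y). f x * g y" UNIV "\<lambda>_. UNIV"]
    by (auto simp: norm_mult infsum_cmult_right' abs_mult infsum_nonneg)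
qed

lemma infsum_times:
  fixes f :: "'b \<Rightarrow> 'a :: {real_normed_field, banach}" and g :: "'c \<Rightarrow> 'a"
  assumes f: "abs_summable f" and g: "abs_summable g"
  shows "infsum f UNIV * infsum g UNIV = (\<Sum>\<^sub>\<infinity>(x, y). f x * g y)"
proof -
  have "(\<lambda>(x, y). f x * g y) summable_on UNIV \<times> UNIV"
    using abs_summable_summable[OF abs_summable_times[OF f g]] by simp
  from infsum_Sigma_banach[OF this] show ?thesis
    by (simp add: infsum_cmult_right' infsum_cmult_left')
qed

text \<open>Fubini for a product of two series after a change of lattice coordinates. Its use is in
  the quintuple product, where terms are grouped by the total power of \<open>z\<close>.\<close>

lemma infsum_times_reindex:
  fixes f g :: "int \<Rightarrow> 'a :: {real_normed_field, banach}"
  assumes f: "abs_summable f" and g: "abs_summable g"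
    and bij: "bij (\<lambda>(x, y). (u x y, v x y))"
  shows "infsum f UNIV * infsum g UNIV = (\<Sum>\<^sub>\<infinity>x. \<Sum>\<^sub>\<infinity>y. f (u x y) * g (v x y))"
    and "(\<lambda>x. \<Sum>\<^sub>\<infinity>y. f (u x y) * g (v x y)) summable_on UNIV"
proof -
  have s: "(\<lambda>z. f (fst z) * g (snd z)) summable_on UNIV"
    using abs_summable_summable[OF abs_summable_times[OF f g]]
    by (simp add: case_prod_unfold)
  have s': "(\<lambda>(x, y). f (u x y) * g (v x y)) summable_on UNIV \<times> UNIV"
    using s summable_on_reindex_bij_betw[OF bij, of "\<lambda>z. f (fst z) * g (snd z)"]
    by (simp add: case_prod_unfold)
  have "infsum f UNIV * infsum g UNIV = (\<Sum>\<^sub>\<infinity>z. f (fst z) * g (snd z))"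
    by (simp add: infsum_times[OF f g] case_prod_unfold)
  also have "\<dots> = (\<Sum>\<^sub>\<infinity>(x, y)\<in>UNIV \<times> UNIV. f (u x y) * g (v x y))"
    using infsum_reindex_bij_betw[OF bij, of "\<lambda>z. f (fst z) * g (snd z)"]
    by (simp add: case_prod_unfold)
  also have "\<dots> = (\<Sum>\<^sub>\<infinity>x. \<Sum>\<^sub>\<infinity>y. f (u x y) * g (v x y))"
    using infsum_Sigma_banach[OF s'] by simp
  finally show "infsum f UNIV * infsum g UNIV = (\<Sum>\<^sub>\<infinity>x. \<Sum>\<^sub>\<infinity>y. f (u x y) * g (v x y))" .
  show "(\<lambda>x. \<Sum>\<^sub>\<infinity>y. f (u x y) * g (v x y)) summable_on UNIV"
    using summable_on_Sigma_banach[OF s'] by simp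
qed

lemma bij_int_residue:
  fixes m :: int
  assumes "m > 0"
  shows "bij_betw (\<lambda>(r, h). m * h + r) ({0..<m} \<times> UNIV) UNIV"
  by (rule bij_betwI[where g = "\<lambda>n. (n mod m, n div m)"]) (use assms in auto)

lemma infsum_int_residue:
  fixes f :: "int \<Rightarrow> 'a :: banach"
  assumes "f summable_on UNIV" "m > 0"
  shows "(\<Sum>\<^sub>\<infinity>n. f n) = (\<Sum>r\<in>{0..<m}. \<Sum>\<^sub>\<infinity>h. f (m * h + r))"
proof -
  note bij = bij_int_residue[OF assms(2)]
  have "(\<lambda>(r, h). f (m * h + r)) summable_on {0..<m} \<times> UNIV"
    using assms(1) summable_on_reindex_bij_betw[OF bij, of f] by (simp add: case_prod_unfold)
  from infsum_Sigma_banach[OF this]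
  have "(\<Sum>\<^sub>\<infinity>(r, h)\<in>{0..<m} \<times> UNIV. f (m * h + r)) = (\<Sum>r\<in>{0..<m}. \<Sum>\<^sub>\<infinity>h. f (m * h + r))"
    by simp
  then show ?thesis
    using infsum_reindex_bij_betw[OF bij, of f] by (simp add: case_prod_unfold)
qed

lemma infsum_int_shift: "(\<Sum>\<^sub>\<infinity>n. f (n + c)) = (\<Sum>\<^sub>\<infinity>n::int. f n)"
  using infsum_reindex_bij_betw[OF bij_plus_right[of c], of f] by (simp add: add.commute)

lemma infsum_int_reflect: "(\<Sum>\<^sub>\<infinity>n. f (c - n)) = (\<Sum>\<^sub>\<infinity>n::int. f n)"
proof -
  have "bij (\<lambda>n. c - n :: int)"
    by (rule bij_betwI[where g = "\<lambda>n. c - n"]) auto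
  from infsum_reindex_bij_betw[OF this, of f] show ?thesis .
qed

subsection \<open>The Jacobi triple product\<close>

text \<open>The \<open>q\<close>-Pochhammer symbol with infinitely many factors. The field is kept
  general because the five-dissection is evaluated at complex fifth roots of a real
  \<open>q\<close>.\<close>

definition qpoch :: "'a \<Rightarrow> 'a \<Rightarrow> 'a :: {real_normed_field, banach}" where
  "qpoch a q = (\<Prod>n. 1 - a * q ^ n)"

lemma convergent_prod_qpoch:
  fixes a q :: "'a :: {real_normed_field, banach}"
  assumes "norm q < 1"
  shows "convergent_prod (\<lambda>n. 1 - a * q ^ n)"
proof (rule abs_convergent_prod_imp_convergent_prod, subst abs_convergent_prod_conv_summable)
  show "summable (\<lambda>i. norm (1 - a * q ^ i - 1))"
    using assms by (auto simp: norm_mult norm_power intro!: summable_mult summable_geometric)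
qed

lemma qpoch_LIMSEQ:
  fixes a q :: "'a :: {real_normed_field, banach}"
  assumes "norm q < 1"
  shows "(\<lambda>n. \<Prod>k<n. 1 - a * q ^ k) \<longlonglongrightarrow> qpoch a q"
  using convergent_prod_LIMSEQ[OF convergent_prod_qpoch[OF assms, of a]]
  unfolding qpoch_def by (subst LIMSEQ_lessThan_iff_atMost)

lemma one_minus_power_nonzero:
  fixes q :: "'a :: real_normed_field"
  assumes "norm q < 1" "k > 0"
  shows "1 - q ^ k \<noteq> 0"
proof
  assume "1 - q ^ k = 0"
  then have "norm q ^ k = 1" by (metis eq_iff_diff_eq_0 norm_one norm_power)
  moreover have "norm q ^ k < 1" using assms by (simp add: power_less_one_iff)
  ultimately show False by simp
qed

lemma qpoch_self_nonzero:
  fixes q :: "'a :: {real_normed_field, banach}"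
  assumes "norm q < 1"
  shows "qpoch q q \<noteq> 0"
  unfolding qpoch_def
  by (rule prodinf_nonzero[OF convergent_prod_qpoch[OF assms]])
    (use one_minus_power_nonzero[OF assms, of "Suc _"] in auto)

section \<open>Gaussian binomial coefficients and the finite triple product\<close>

definition qfact :: "'a \<Rightarrow> nat \<Rightarrow> 'a :: real_normed_field" where
  "qfact q n = (\<Prod>k<n. 1 - q ^ Suc k)"

lemma qfact_0 [simp]: "qfact q 0 = 1"
  and qfact_Suc: "qfact q (Suc n) = qfact q n * (1 - q ^ Suc n)"
  by (simp_all add: qfact_def)

lemma qfact_nonzero:
  assumes "norm q < 1"
  shows "qfact q n \<noteq> 0"
  using one_minus_power_nonzero[OF assms, of "Suc _"] by (simp add: qfact_def)

lemma qfact_LIMSEQ: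
  fixes q :: "'a :: {real_normed_field, banach}"
  assumes "norm q < 1"
  shows "qfact q \<longlonglongrightarrow> qpoch q q"
  using qpoch_LIMSEQ[OF assms, of q] unfolding qfact_def by simp

text \<open>The Gaussian binomial coefficient. For \<open>k > n\<close> the truncated subtraction
  gives a meaningless value instead of 0, which is why the Pascal rule is stated for
  \<open>k < n\<close> and boundary terms are handled apart.\<close>

definition qbinom :: "'a \<Rightarrow> nat \<Rightarrow> nat \<Rightarrow> 'a :: real_normed_field" where
  "qbinom q n k = qfact q n / (qfact q k * qfact q (n - k))"

lemma qbinom_0 [simp]: "norm q < 1 \<Longrightarrow> qbinom q n 0 = 1"
  and qbinom_self [simp]: "norm q < 1 \<Longrightarrow> qbinom q n n = 1"
  by (simp_all add: qbinom_def qfact_nonzero)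

lemma qbinom_Suc_Suc:
  assumes "norm q < 1" "k < n"
  shows "qbinom q (Suc n) (Suc k) = qbinom q n (Suc k) + q ^ (n - k) * qbinom q n k"
proof -
  obtain d where d: "n = Suc (k + d)" using assms(2) less_imp_Suc_add by blast
  have nz: "1 - q ^ Suc k \<noteq> 0" "1 - q ^ Suc d \<noteq> 0" "qfact q k \<noteq> 0" "qfact q d \<noteq> 0"
    using assms(1) by (simp_all only: one_minus_power_nonzero qfact_nonzero zero_less_Suc not_False_eq_True)
  have "qbinom q (Suc n) (Suc k) = qfact q n * (1 - q ^ (Suc k + Suc d)) / (qfact q k * (1 - q ^ Suc k) * (qfact q d * (1 - q ^ Suc d)))"
    unfolding qbinom_def d by (simp add: qfact_Suc)
  \<comment> \<open>The Pascal rule is this splitting of the last factor of the numerator: the first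
    part cancels against \<open>1 - q ^ Suc d\<close>, the second against
    \<open>1 - q ^ Suc k\<close>.\<close>
  also have "1 - q ^ (Suc k + Suc d) = (1 - q ^ Suc d) + q ^ Suc d * (1 - q ^ Suc k)"
    by (simp add: algebra_simps power_add)
  also have "qfact q n * ((1 - q ^ Suc d) + q ^ Suc d * (1 - q ^ Suc k)) / (qfact q k * (1 - q ^ Suc k) * (qfact q d * (1 - q ^ Suc d)))
    = qfact q n / (qfact q k * (1 - q ^ Suc k) * qfact q d) + q ^ Suc d * (qfact q n / (qfact q k * (qfact q d * (1 - q ^ Suc d))))"
    using nz by (simp add: divide_simps del: power_Suc) (simp add: algebra_simps del: power_Suc)
  also have "\<dots> = qbinom q n (Suc k) + q ^ (n - k) * qbinom q n k"
    unfolding qbinom_def d by (simp add: qfact_Suc Suc_diff_le)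
  finally show ?thesis .
qed

text \<open>Multiplying by the next factor gives the Pascal rule coefficientwise: its
  \<open>q ^ (n - k)\<close> and the \<open>q ^ k\<close> by which the triangular exponent grows
  combine to the \<open>q ^ n\<close> of the new factor.\<close>

lemma q_binomial_theorem:
  fixes q x :: "'a :: real_normed_field"
  assumes "norm q < 1"
  shows "(\<Prod>k<n. 1 + x * q ^ k) = (\<Sum>k\<le>n. qbinom q n k * q ^ (k * (k - 1) div 2) * x ^ k)"
proof (induction n)
  case 0
  then show ?case using assms by simp
next
  case (Suc n)
  define t where "t k = q ^ (k * (k - 1) div 2)" for k
  have t_Suc: "t (Suc k) = t k * q ^ k" for k
  proof -
    have "Suc k * k div 2 = k * (k - 1) div 2 + k"
      by (cases k) (auto simp: algebra_simps)
    then show ?thesis by (simp add: t_def power_add)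
  qed
  define a where "a k = qbinom q n k * t k * x ^ k" for k
  have "(\<Prod>k<Suc n. 1 + x * q ^ k) = (\<Sum>k\<le>n. a k) * (1 + x * q ^ n)"
    using Suc.IH by (simp add: a_def t_def)
  also have "\<dots> = (\<Sum>k\<le>n. a k) + (\<Sum>k\<le>n. a k * (x * q ^ n))"
    by (simp add: distrib_left sum_distrib_right)
  also have "(\<Sum>k\<le>n. a k) = a 0 + (\<Sum>k<n. a (Suc k))"
    by (simp add: sum.atMost_shift)
  also have "(\<Sum>k\<le>n. a k * (x * q ^ n)) = (\<Sum>k<n. a k * (x * q ^ n)) + a n * (x * q ^ n)"
    by (simp add: lessThan_Suc_atMost[symmetric])
  also have "a 0 + (\<Sum>k<n. a (Suc k)) + ((\<Sum>k<n. a k * (x * q ^ n)) + a n * (x * q ^ n))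
     = a 0 + (\<Sum>k<n. a (Suc k) + a k * (x * q ^ n)) + a n * (x * q ^ n)"
    by (simp add: sum.distrib)
  also have "(\<Sum>k<n. a (Suc k) + a k * (x * q ^ n)) = (\<Sum>k<n. qbinom q (Suc n) (Suc k) * t (Suc k) * x ^ Suc k)"
  proof (rule sum.cong, simp)
    fix k assume "k \<in> {..<n}"
    then have k: "k < n" by simp
    then have "q ^ n = q ^ (n - k) * q ^ k" by (simp flip: power_add)
    then show "a (Suc k) + a k * (x * q ^ n) = qbinom q (Suc n) (Suc k) * t (Suc k) * x ^ Suc k"
      by (simp add: a_def qbinom_Suc_Suc[OF assms k] t_Suc algebra_simps)
  qed
  also have "a 0 = qbinom q (Suc n) 0 * t 0 * x ^ 0"
    using assms by (simp add: a_def)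
  also have "a n * (x * q ^ n) = qbinom q (Suc n) (Suc n) * t (Suc n) * x ^ Suc n"
    using assms by (simp add: a_def t_Suc)
  also have "qbinom q (Suc n) 0 * t 0 * x ^ 0 + (\<Sum>k<n. qbinom q (Suc n) (Suc k) * t (Suc k) * x ^ Suc k)
     + qbinom q (Suc n) (Suc n) * t (Suc n) * x ^ Suc n = (\<Sum>k\<le>Suc n. qbinom q (Suc n) k * t k * x ^ k)"
    by (subst sum.atMost_shift) simp
  finally show ?case by (simp add: t_def)
qed

lemma prod_lessThan_add:
  fixes g :: "nat \<Rightarrow> 'a :: comm_monoid_mult"
  shows "(\<Prod>k<m + n. g k) = (\<Prod>k<m. g k) * (\<Prod>k<n. g (m + k))"
  by (induction n) (simp_all add: mult_ac)

text \<open>The division is exact. Exponent identities below are proved after doubling, through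
  \<open>two_times_tri\<close>, where they are polynomial.\<close>

definition tri :: "int \<Rightarrow> int" where
  "tri n = n * (n - 1) div 2"

lemma two_times_tri: "2 * tri n = n * (n - 1)"
  by (simp add: tri_def)

lemma tri_minus: "tri (- n) = tri n + n"
  and tri_add_1: "tri (n + 1) = tri n + n"
  using two_times_tri[of n] two_times_tri[of "- n"] two_times_tri[of "n + 1"]
  by (simp_all add: algebra_simps)

lemma two_times_triangle: "2 * (n * (n + 1) div 2) = n * (n + 1 :: int)"
  by simp

definition jterm :: "'a \<Rightarrow> 'a \<Rightarrow> int \<Rightarrow> 'a :: real_normed_field" where
  "jterm z q n = (- z) powi n * q powi tri n"

definition jtheta :: "'a \<Rightarrow> 'a \<Rightarrow> 'a :: {real_normed_field, banach}" where
  "jtheta z q = (\<Sum>\<^sub>\<infinity>n. jterm z q n)"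

text \<open>The finite form of the triple product is the q-binomial theorem of even order,
  recentred at its middle term.\<close>

lemma finite_triple_product:
  fixes q z :: "'a :: real_normed_field"
  assumes "norm q < 1" "q \<noteq> 0" "z \<noteq> 0"
  shows "(\<Prod>k<n. 1 - z * q ^ k) * (\<Prod>k<n. 1 - q / z * q ^ k) =
    (\<Sum>j\<in>{- int n..int n}. qbinom q (2 * n) (nat (int n + j)) * jterm z q j)"
proof -
  \<comment> \<open>With this \<open>x\<close> the upper half of the factors is
    \<open>1 - z * q ^ k\<close>. The lower half consists of \<open>1 - z / q ^ j\<close> with
    \<open>1 \<le> j \<le> n\<close>; pulling \<open>- z / q ^ j\<close> out of each leaves the
    factors in \<open>q / z\<close>, and \<open>B\<close> is the product of what was pulled
    out.\<close>
  define x where "x = - z * q powi (- int n)"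
  define B where "B = (- z) ^ n * q powi (- (int n * (int n + 1) div 2))"
  have B: "B \<noteq> 0" using assms by (simp add: B_def)
  have "(\<Prod>k<2*n. 1 + x * q ^ k) = (\<Prod>k<n. 1 + x * q ^ k) * (\<Prod>k<n. 1 + x * q ^ (n + k))"
    unfolding mult_2 by (rule prod_lessThan_add)
  also have "(\<Prod>k<n. 1 + x * q ^ (n + k)) = (\<Prod>k<n. 1 - z * q ^ k)"
    using assms by (intro prod.cong) (auto simp: x_def power_add power_int_minus field_simps)
  also have "(\<Prod>k<n. 1 + x * q ^ k) = (\<Prod>k<n. 1 + x * q ^ (n - Suc k))"
    by (rule prod.nat_diff_reindex[symmetric])
  also have "\<dots> = (\<Prod>k<n. (- z * q powi (- int (Suc k))) * (1 - q / z * q ^ k))"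
  proof (rule prod.cong, simp)
    fix k assume "k \<in> {..<n}"
    then have "q ^ (n - Suc k) = q powi (int n - int (Suc k))"
      by (metis Suc_leI lessThan_iff of_nat_diff power_int_of_nat)
    then have "x * q ^ (n - Suc k) = - z * q powi (- int (Suc k))"
      using assms by (simp add: x_def power_int_diff power_int_minus field_simps del: of_nat_Suc)
    moreover have "q powi (- int (Suc k)) * (q * q ^ k) = 1"
      unfolding power_int_minus power_int_of_nat using assms by (simp add: field_simps)
    ultimately show "1 + x * q ^ (n - Suc k) = (- z * q powi (- int (Suc k))) * (1 - q / z * q ^ k)"
      using assms(3) by (simp add: algebra_simps del: of_nat_Suc)
  qed
  also have "\<dots> = (\<Prod>k<n. - z * q powi (- int (Suc k))) * (\<Prod>k<n. 1 - q / z * q ^ k)"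
    by (rule prod.distrib)
  also have "(\<Prod>k<n. - z * q powi (- int (Suc k))) = B"
    unfolding B_def
  proof (induction n)
    case 0
    show ?case by simp
  next
    case (Suc n)
    have "- (int (Suc n) * (int (Suc n) + 1) div 2) = - (int n * (int n + 1) div 2) + (- int (Suc n))"
      using two_times_triangle[of "int n"] two_times_triangle[of "int (Suc n)"]
      by (simp add: algebra_simps)
    then have "q powi (- (int (Suc n) * (int (Suc n) + 1) div 2))
        = q powi (- (int n * (int n + 1) div 2)) * q powi (- int (Suc n))"
      using assms(2) by (simp only: power_int_add simp_thms)
    then show ?case using Suc by (simp add: mult_ac del: of_nat_Suc)
  qed
  finally have "(\<Prod>k<n. 1 - z * q ^ k) * (\<Prod>k<n. 1 - q / z * q ^ k) = (\<Prod>k<2*n. 1 + x * q ^ k) / B"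
    using B by (simp add: field_simps)
  also have "\<dots> = (\<Sum>k\<le>2*n. qbinom q (2*n) k * (q ^ (k * (k - 1) div 2) * x ^ k / B))"
    by (simp add: q_binomial_theorem[OF assms(1)] sum_divide_distrib mult.assoc)
  also have "\<dots> = (\<Sum>j\<in>{- int n..int n}. qbinom q (2 * n) (nat (int n + j)) * jterm z q j)"
  proof (rule sum.reindex_bij_witness[where i = "\<lambda>j. nat (int n + j)" and j = "\<lambda>k. int k - int n"])
    fix k assume "k \<in> {..2 * n}"
    define j where "j = int k - int n"
    have k: "int (k * (k - 1) div 2) = int k * (int k - 1) div 2"
      by (cases k) (auto simp: zdiv_int algebra_simps)
    have "2 * tri j = 2 * (int k * (int k - 1) div 2) - 2 * (int n * int k) + 2 * (int n * (int n + 1) div 2)"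
      unfolding two_times_triangle two_times_tri by (simp add: j_def algebra_simps)
    then have e: "tri j = int (k * (k - 1) div 2) + - int n * int k + (int n * (int n + 1) div 2)"
      unfolding k by linarith
    have "q powi tri j = q ^ (k * (k - 1) div 2) * q powi (- int n * int k) * q powi (int n * (int n + 1) div 2)"
      unfolding e using assms(2) by (simp only: power_int_add power_int_of_nat simp_thms)
    moreover have "(- z) powi j = (- z) ^ k / (- z) ^ n"
      using assms by (simp add: j_def power_int_diff)
    moreover have "x ^ k = (- z) ^ k * q powi (- int n * int k)"
      by (simp only: x_def power_mult_distrib power_int_power')
    ultimately have "jterm z q j = q ^ (k * (k - 1) div 2) * x ^ k / B"
      using assms by (simp only: jterm_def B_def power_int_minus_divide) (simp add: divide_simps)
    then show "qbinom q (2 * n) (nat (int n + (int k - int n))) * jterm z q (int k - int n) =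
        qbinom q (2 * n) k * (q ^ (k * (k - 1) div 2) * x ^ k / B)"
      by (simp add: j_def)
  qed auto
  finally show ?thesis .
qed

text \<open>Coefficients near the middle tend to \<open>1 / qpoch q q\<close>, and all coefficients
  are uniformly bounded because \<open>qfact q\<close> and its inverse both converge. The sequence
  \<open>s\<close> is arbitrary so that the lemma serves both \<open>jterm\<close> and the
  differentiated terms in \<open>jacobi_cube\<close>.\<close>

lemma qbinom_sum_LIMSEQ:
  fixes q :: "'a :: {real_normed_field, banach}"
  assumes q: "norm q < 1" and s: "abs_summable s"
  shows "(\<lambda>n. \<Sum>j\<in>{- int n..int n}. qbinom q (2 * n) (nat (int n + j)) * s j)
           \<longlonglongrightarrow> (\<Sum>\<^sub>\<infinity>j. s j) / qpoch q q"
proof -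
  \<comment> \<open>Extending the finite sums by zero gives all of them the same index set, as
    dominated convergence requires.\<close>
  define a where "a j n = (if j \<in> {- int n..int n} then qbinom q (2 * n) (nat (int n + j)) * s j else 0)" for j n
  note P = qpoch_self_nonzero[OF q]
  obtain K1 where K1: "\<And>n. norm (qfact q n) \<le> K1" and "K1 > 0"
    using convergent_imp_Bseq[of "qfact q"] qfact_LIMSEQ[OF q] unfolding convergent_def Bseq_def by blast
  have "(\<lambda>n. inverse (qfact q n)) \<longlonglongrightarrow> inverse (qpoch q q)"
    by (intro tendsto_inverse qfact_LIMSEQ q P)
  then obtain K2 where K2: "\<And>n. norm (inverse (qfact q n)) \<le> K2" and "K2 > 0"
    using convergent_imp_Bseq[of "\<lambda>n. inverse (qfact q n)"] unfolding convergent_def Bseq_def by blast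
  have bnd: "norm (qbinom q n k) \<le> K1 * K2 * K2" for n k
  proof -
    have "norm (qbinom q n k) = norm (qfact q n) * norm (inverse (qfact q k)) * norm (inverse (qfact q (n - k)))"
      by (simp add: qbinom_def norm_mult norm_divide norm_inverse field_simps)
    also have "\<dots> \<le> K1 * K2 * K2"
      using K1 K2 \<open>K1 > 0\<close> \<open>K2 > 0\<close> by (intro mult_mono) auto
    finally show ?thesis .
  qed
  have "(\<lambda>n. \<Sum>\<^sub>\<infinity>j. a j n) \<longlonglongrightarrow> (\<Sum>\<^sub>\<infinity>j. s j / qpoch q q)"
  proof (rule tannery_int)
    show "norm (a j n) \<le> K1 * K2 * K2 * norm (s j)" for j n
      using mult_right_mono[OF bnd norm_ge_zero] \<open>K1 > 0\<close> \<open>K2 > 0\<close> by (auto simp: a_def norm_mult)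
    show "(\<lambda>j. K1 * K2 * K2 * norm (s j)) summable_on UNIV"
      using s by (rule summable_on_cmult_right)
    fix j :: int
    have "filterlim (\<lambda>n. 2 * n) sequentially sequentially"
      by (rule filterlim_subseq) (auto simp: strict_mono_def)
    moreover have "filterlim (\<lambda>n. nat (int n + j)) sequentially sequentially"
      by (rule filterlim_at_top_mono[OF filterlim_minus_const_nat_at_top[of "nat \<bar>j\<bar>"]],
          rule always_eventually, arith)
    moreover have "filterlim (\<lambda>n. nat (int n - j)) sequentially sequentially"
      by (rule filterlim_at_top_mono[OF filterlim_minus_const_nat_at_top[of "nat \<bar>j\<bar>"]],
          rule always_eventually, arith)
    ultimately have "(\<lambda>n. qfact q (2 * n) / (qfact q (nat (int n + j)) * qfact q (nat (int n - j))) * s j)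
        \<longlonglongrightarrow> qpoch q q / (qpoch q q * qpoch q q) * s j"
      by (intro tendsto_intros filterlim_compose[OF qfact_LIMSEQ[OF q]]) (use P in auto)
    moreover have "\<forall>\<^sub>F n in sequentially.
        qfact q (2 * n) / (qfact q (nat (int n + j)) * qfact q (nat (int n - j))) * s j = a j n"
      using eventually_ge_at_top[of "nat \<bar>j\<bar>"]
    proof eventually_elim
      case (elim n)
      then have "j \<in> {- int n..int n}" and "2 * n - nat (int n + j) = nat (int n - j)" by auto
      then show ?case by (simp add: a_def qbinom_def)
    qed
    ultimately show "a j \<longlonglongrightarrow> s j / qpoch q q"
      using P by (auto intro: Lim_transform_eventually simp: field_simps)
  qed
  moreover have "(\<Sum>\<^sub>\<infinity>j. a j n) = (\<Sum>j\<in>{- int n..int n}. qbinom q (2 * n) (nat (int n + j)) * s j)" for n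
  proof -
    have "(\<Sum>\<^sub>\<infinity>j. a j n) = (\<Sum>\<^sub>\<infinity>j\<in>{- int n..int n}. qbinom q (2 * n) (nat (int n + j)) * s j)"
      by (rule infsum_cong_neutral) (auto simp: a_def)
    then show ?thesis by simp
  qed
  moreover have "(\<Sum>\<^sub>\<infinity>j. s j / qpoch q q) = (\<Sum>\<^sub>\<infinity>j. s j) / qpoch q q"
    using infsum_cmult_left'[of s "inverse (qpoch q q)" UNIV] by (simp add: divide_inverse)
  ultimately show ?thesis by simp
qed

text \<open>For \<open>n \<ge> 0\<close> the decay comes from \<open>z\<close> alone. For
  \<open>n < 0\<close> the inequality \<open>tri n \<ge> - n\<close> trades a power of
  \<open>q\<close> against the growing power of \<open>z\<close>, which leaves powers of
  \<open>q / z\<close>. This is where the annulus comes from.\<close>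

lemma jterm_bound:
  fixes q z :: "'a :: real_normed_field"
  assumes "norm q < norm z" "norm z < 1" "q \<noteq> 0"
  shows "norm (jterm z q n) \<le> max (norm z) (norm q / norm z) ^ nat \<bar>n\<bar>"
proof -
  have z: "norm z > 0" "norm q > 0" "norm q \<le> 1" using assms by auto
  have e0: "tri n \<ge> 0"
  proof -
    have "n * (n - 1) \<ge> 0" by (cases "n \<ge> 1") (auto intro: mult_nonneg_nonneg mult_nonpos_nonpos)
    then show ?thesis by (simp add: tri_def)
  qed
  have N: "norm (jterm z q n) = norm z powi n * norm q powi tri n"
    by (simp add: jterm_def norm_mult norm_power_int)
  show ?thesis
  proof (cases "n \<ge> 0")
    case True
    have "norm q powi tri n \<le> 1"
      using e0 z by (intro power_int_le_one) auto
    then have "norm (jterm z q n) \<le> norm z powi n"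
      unfolding N using z by (simp add: mult_left_le)
    also have "\<dots> = norm z ^ nat \<bar>n\<bar>" using True by (simp add: power_int_def)
    also have "\<dots> \<le> max (norm z) (norm q / norm z) ^ nat \<bar>n\<bar>"
      by (intro power_mono) auto
    finally show ?thesis .
  next
    case False
    then have "n * (n - 1) \<ge> 2 * (- n)"
      using mult_left_mono_neg[of "n - 1" "-2" n] by simp
    then have "norm q powi tri n \<le> norm q powi (- n)"
      using z assms two_times_tri[of n] by (intro power_int_decreasing) auto
    then have "norm (jterm z q n) \<le> norm z powi n * norm q powi (- n)"
      unfolding N using z by (intro mult_left_mono) auto
    also have "\<dots> = (norm q / norm z) ^ nat \<bar>n\<bar>"
      using False by (simp add: power_int_def power_divide field_simps)
    also have "\<dots> \<le> max (norm z) (norm q / norm z) ^ nat \<bar>n\<bar>"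
      by (intro power_mono) auto
    finally show ?thesis .
  qed
qed

lemma jterm_abs_summable:
  fixes q z :: "'a :: real_normed_field"
  assumes "norm q < norm z" "norm z < 1" "q \<noteq> 0"
  shows "abs_summable (jterm z q)"
proof (rule Infinite_Sum.abs_summable_on_comparison_test')
  have "norm z > 0" using assms by auto
  then have "0 \<le> max (norm z) (norm q / norm z)" "max (norm z) (norm q / norm z) < 1"
    using assms by (auto simp: le_max_iff_disj)
  from summable_on_int_poly_geometric[OF this, of 1 0]
  show "(\<lambda>n. max (norm z) (norm q / norm z) ^ nat \<bar>n\<bar>) summable_on (UNIV :: int set)"
    by simp
qed (use jterm_bound[OF assms] in simp)

theorem jacobi_triple_product:
  fixes q z :: "'a :: {real_normed_field, banach}"
  assumes "norm q < norm z" "norm z < 1" "q \<noteq> 0"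
  shows "jtheta z q = qpoch z q * qpoch (q / z) q * qpoch q q"
proof -
  have q: "norm q < 1" and z: "z \<noteq> 0" using assms by auto
  have "(\<lambda>n. (\<Prod>k<n. 1 - z * q ^ k) * (\<Prod>k<n. 1 - q / z * q ^ k)) \<longlonglongrightarrow> jtheta z q / qpoch q q"
    unfolding jtheta_def finite_triple_product[OF q assms(3) z]
    by (rule qbinom_sum_LIMSEQ[OF q jterm_abs_summable[OF assms]])
  moreover have "(\<lambda>n. (\<Prod>k<n. 1 - z * q ^ k) * (\<Prod>k<n. 1 - q / z * q ^ k)) \<longlonglongrightarrow> qpoch z q * qpoch (q / z) q"
    by (intro tendsto_mult qpoch_LIMSEQ q)
  ultimately have "jtheta z q / qpoch q q = qpoch z q * qpoch (q / z) q"
    by (rule LIMSEQ_unique)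
  then show ?thesis using qpoch_self_nonzero[OF q] by (simp add: field_simps)
qed

lemma tri_ge: "tri n \<ge> \<bar>n\<bar> - (1 :: int)"
proof -
  have "n * (n - 1) \<ge> 2 * (\<bar>n\<bar> - 1)"
  proof (cases "n \<ge> 1")
    case True
    have "(n - 1) * (n - 2) \<ge> 0"
      using True by (cases "n = 1") auto
    then show ?thesis using True by (simp add: algebra_simps)
  next
    case False
    then have "n * (n + 1) \<ge> 0" by (cases "n = 0") (auto intro: mult_nonpos_nonpos)
    then show ?thesis using False by (simp add: algebra_simps)
  qed
  then show ?thesis by (simp add: tri_def)
qed

text \<open>Linear growth of the exponent is enough for a geometric majorant. The constant
  \<open>c\<close> allows finitely many negative exponents, at the price of a fixed factor
  \<open>q powi (- c)\<close>.\<close>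

lemma weighted_theta_abs_summable:
  fixes q :: real
  assumes "0 < q" "q < 1" "\<And>n. e n \<ge> \<bar>n\<bar> - c" "\<And>n. \<bar>w n\<bar> \<le> C * real_of_int (1 + \<bar>n\<bar>) ^ k"
  shows "abs_summable (\<lambda>n::int. w n * q powi e n)"
proof (rule Infinite_Sum.abs_summable_on_comparison_test')
  show "(\<lambda>n::int. C * q powi (- c) * (real_of_int (1 + \<bar>n\<bar>) ^ k * q ^ nat \<bar>n\<bar>)) summable_on UNIV"
    by (rule summable_on_int_poly_geometric) (use assms in auto)
  fix n :: int
  have "q powi e n \<le> q powi (\<bar>n\<bar> - c)"
    using assms by (intro power_int_decreasing) auto
  also have "\<dots> = q powi (- c) * q ^ nat \<bar>n\<bar>"
    using assms by (simp add: power_int_diff power_int_minus field_simps power_int_nonneg_exp)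
  finally have "\<bar>w n\<bar> * q powi e n \<le> C * real_of_int (1 + \<bar>n\<bar>) ^ k * (q powi (- c) * q ^ nat \<bar>n\<bar>)"
    using assms order_trans[OF abs_ge_zero assms(4)[of n]] by (intro mult_mono) auto
  then show "norm (w n * q powi e n) \<le> C * q powi (- c) * (real_of_int (1 + \<bar>n\<bar>) ^ k * q ^ nat \<bar>n\<bar>)"
    using assms(1) by (simp add: abs_mult mult_ac)
qed

text \<open>Both sides of the triple product vanish at \<open>z = 1\<close>, so their derivatives
  there are compared. This is done for the finite identity, where differentiation is elementary,
  before passing to the limit.\<close>

theorem jacobi_cube:
  fixes q :: real
  assumes "0 < q" "q < 1"
  shows "(\<Sum>\<^sub>\<infinity>n. (-1) powi n * real_of_int (2 * n + 1) * q powi (tri n + n)) = 2 * qpoch q q ^ 3"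
proof -
  have q: "norm q < 1" "q \<noteq> 0" using assms by auto
  define t where "t n = (-1) powi n * q powi tri n" for n :: int
  define s where "s n = real_of_int n * t n" for n :: int
  have s: "abs_summable s"
    using weighted_theta_abs_summable[OF assms, of 1 "tri" "\<lambda>n. real_of_int n * (-1) powi n" 1 1]
      tri_ge by (simp add: s_def t_def mult_ac abs_mult power_int_abs)
  have t: "abs_summable t"
    using weighted_theta_abs_summable[OF assms, of 1 "tri" "\<lambda>n. (-1) powi n" 1 0]
      tri_ge by (simp add: t_def mult_ac power_int_abs)
  have fin: "(\<Sum>j\<in>{- int (Suc n)..int (Suc n)}. qbinom q (2 * Suc n) (nat (int (Suc n) + j)) * s j)
      = - (qfact q n * qfact q (Suc n))" for n
  proof -
    define g where "g z = (\<Prod>k<n. 1 - z * q ^ Suc k) * (\<Prod>k<Suc n. 1 - q / z * q ^ k)" for z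
    define L where "L z = (1 - z) * g z" for z
    define R where "R z = (\<Sum>j\<in>{- int (Suc n)..int (Suc n)}. qbinom q (2 * Suc n) (nat (int (Suc n) + j)) * jterm z q j)" for z
    have LR: "L z = R z" if "z \<in> {0<..}" for z
      unfolding R_def using that q
      by (subst finite_triple_product[symmetric])
         (auto simp: L_def g_def prod.lessThan_Suc_shift mult_ac simp del: prod.lessThan_Suc)
    \<comment> \<open>Since \<open>L z = (1 - z) * g z\<close>, Caratheodory's criterion gives the
      derivative at 1 from mere continuity of \<open>g\<close>. The finite product has order
      \<open>Suc n\<close> so that the factor \<open>1 - z\<close> is present.\<close>
    have "isCont g 1"
      unfolding g_def by (intro continuous_intros) auto
    then have "(L has_field_derivative - g 1) (at 1)"
      unfolding CARAT_DERIV L_def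
      by (intro exI[of _ "\<lambda>z. - g z"]) (auto simp: algebra_simps intro: continuous_minus)
    moreover have "(R has_field_derivative (\<Sum>j\<in>{- int (Suc n)..int (Suc n)}. qbinom q (2 * Suc n) (nat (int (Suc n) + j)) * s j)) (at 1)"
      unfolding R_def
    proof (intro DERIV_sum DERIV_cmult)
      fix j :: int
      have "jterm z q j = t j * z powi j" for z
        by (simp add: jterm_def t_def power_int_minus_left)
      then show "((\<lambda>z. jterm z q j) has_field_derivative s j) (at 1)"
        by (auto intro!: derivative_eq_intros simp: s_def)
    qed
    then have "(L has_field_derivative (\<Sum>j\<in>{- int (Suc n)..int (Suc n)}. qbinom q (2 * Suc n) (nat (int (Suc n) + j)) * s j)) (at 1)"
      by (rule DERIV_cong_ev[THEN iffD2, rotated -1])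
        (use LR in \<open>auto intro!: eventually_nhds_in_open[of "{0<..}" 1, THEN eventually_mono]\<close>)
    moreover have "g 1 = qfact q n * qfact q (Suc n)"
      by (simp add: g_def qfact_def)
    ultimately show ?thesis using DERIV_unique by fastforce
  qed
  have "(\<lambda>n. - (qfact q n * qfact q (Suc n))) \<longlonglongrightarrow> infsum s UNIV / qpoch q q"
    using LIMSEQ_Suc[OF qbinom_sum_LIMSEQ[OF q(1) s]] unfolding fin .
  moreover have "(\<lambda>n. - (qfact q n * qfact q (Suc n))) \<longlonglongrightarrow> - (qpoch q q * qpoch q q)"
    by (intro tendsto_intros qfact_LIMSEQ LIMSEQ_Suc q)
  ultimately have "infsum s UNIV / qpoch q q = - (qpoch q q * qpoch q q)"
    by (rule LIMSEQ_unique)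
  then have S: "infsum s UNIV = - (qpoch q q ^ 3)"
    using qpoch_self_nonzero[OF q(1)] by (simp add: field_simps power3_eq_cube)
  \<comment> \<open>The indices \<open>- n\<close> and \<open>n + 1\<close> share the exponent
    \<open>tri n + n\<close>, so their weights merge into \<open>2 * n + 1\<close>. Each of the two
    sums is a full copy of \<open>infsum s UNIV\<close>, hence the factor 2 in the theorem.\<close>
  have r: "s (0 - n) + s (n + 1) = - ((-1) powi n * real_of_int (2 * n + 1) * q powi (tri n + n))" for n
    by (simp add: s_def t_def tri_add_1 tri_add_1[of n, simplified add.commute[of n]] tri_minus power_int_minus_one_minus power_int_add algebra_simps)
  have "(\<lambda>n. s (0 - n)) summable_on UNIV"
    using abs_summable_summable[OF s] summable_on_reindex_bij_betw[of "\<lambda>n::int. 0 - n" UNIV UNIV s]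
      bij_uminus by simp
  moreover have "(\<lambda>n. s (n + 1)) summable_on UNIV"
    using abs_summable_summable[OF s] summable_on_reindex_bij_betw[OF bij_plus_right[of 1], of s]
    by (simp add: add.commute)
  ultimately have "(\<Sum>\<^sub>\<infinity>n. s (0 - n) + s (n + 1)) = infsum s UNIV + infsum s UNIV"
    by (subst infsum_add) (simp_all only: infsum_int_reflect infsum_int_shift)
  then show ?thesis
    unfolding r S by (simp add: infsum_uminus)
qed

subsection \<open>Theta products and the quintuple product\<close>

lemma qpoch_pos:
  fixes a q :: real
  assumes "\<bar>a\<bar> < 1" "0 \<le> q" "q < 1"
  shows "qpoch a q > 0"
  unfolding qpoch_def
proof (rule less_0_prodinf[OF convergent_prod_qpoch])
  fix n
  have "\<bar>a * q ^ n\<bar> \<le> \<bar>a\<bar>"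
    using assms by (simp add: abs_mult power_le_one mult_left_le)
  then show "0 < 1 - a * q ^ n" using assms by linarith
qed (use assms in auto)

lemma ramanujan_f_minus: "ramanujan_f (- q) = qpoch q q"
  by (simp add: ramanujan_f_def qpoch_def)

text \<open>Factors are sorted by the residue of their exponent modulo \<open>m\<close>. The sorting
  takes place in the partial products of length \<open>m * n\<close>, so no infinite product is
  rearranged.\<close>

lemma qpoch_dissect:
  fixes a q :: "'a :: {real_normed_field, banach}"
  assumes q: "norm q < 1" and m: "m > 0"
  shows "qpoch a q = (\<Prod>i<m. qpoch (a * q ^ i) (q ^ m))"
proof -
  have *: "(\<Prod>k<m * n. 1 - a * q ^ k) = (\<Prod>i<m. \<Prod>k<n. 1 - a * q ^ i * (q ^ m) ^ k)" for n
  proof (induction n)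
    case (Suc n)
    have "(\<Prod>k<m * Suc n. 1 - a * q ^ k) = (\<Prod>k<m * n + m. 1 - a * q ^ k)"
      by (simp add: add.commute)
    also have "\<dots> = (\<Prod>k<m * n. 1 - a * q ^ k) * (\<Prod>i<m. 1 - a * q ^ (m * n + i))"
      by (rule prod_lessThan_add)
    also have "\<dots> = (\<Prod>i<m. \<Prod>k<Suc n. 1 - a * q ^ i * (q ^ m) ^ k)"
      unfolding Suc by (simp add: prod.distrib[symmetric] power_add power_mult mult_ac)
    finally show ?case .
  qed simp
  have "norm (q ^ m) < 1"
    using q m by (simp add: norm_power power_less_one_iff)
  then have "(\<lambda>n. \<Prod>i<m. \<Prod>k<n. 1 - a * q ^ i * (q ^ m) ^ k) \<longlonglongrightarrow> (\<Prod>i<m. qpoch (a * q ^ i) (q ^ m))"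
    by (intro tendsto_prod qpoch_LIMSEQ)
  moreover have "filterlim (\<lambda>n. m * n) sequentially sequentially"
    using m by (intro filterlim_subseq) (auto simp: strict_mono_def)
  from filterlim_compose[OF qpoch_LIMSEQ[OF q, of a] this]
  have "(\<lambda>n. \<Prod>k<m * n. 1 - a * q ^ k) \<longlonglongrightarrow> qpoch a q" .
  ultimately show ?thesis
    unfolding * by (metis LIMSEQ_unique)
qed

lemma qpoch_times_minus:
  fixes a q :: "'a :: {real_normed_field, banach}"
  assumes "norm q < 1"
  shows "qpoch a q * qpoch (- a) q = qpoch (a ^ 2) (q ^ 2)"
proof -
  have "qpoch a q * qpoch (- a) q = (\<Prod>n. (1 - a * q ^ n) * (1 - - a * q ^ n))"
    unfolding qpoch_def by (intro prodinf_mult convergent_prod_qpoch assms)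
  also have "(\<lambda>n. (1 - a * q ^ n) * (1 - - a * q ^ n)) = (\<lambda>n. 1 - a ^ 2 * (q ^ 2) ^ n)"
    by (auto simp: fun_eq_iff algebra_simps power2_eq_square power_mult_distrib)
  finally show ?thesis by (simp add: qpoch_def)
qed

lemma jterm_monomial:
  assumes "q \<noteq> 0"
  shows "jterm (c * q ^ i) (q ^ m) n = (- c) powi n * q powi (int i * n + int m * tri n)"
proof -
  have "(- (c * q ^ i)) powi n = ((- c) * q ^ i) powi n" by simp
  also have "\<dots> = (- c) powi n * q powi (int i * n)"
    by (simp only: power_int_mult_distrib power_int_power)
  finally show ?thesis
    using assms unfolding jterm_def by (simp add: power_int_add power_int_power mult.assoc)
qed

lemma norm_power_less:
  fixes q :: "'a :: real_normed_field"
  assumes "q \<noteq> 0" "norm q < 1" "i < m"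
  shows "norm (q ^ m) < norm (q ^ i)"
  using assms by (simp add: norm_power power_strict_decreasing)

text \<open>The triple product at \<open>z = c * q ^ i\<close> in base \<open>q ^ m\<close>. As
  \<open>c\<close> is its own inverse, \<open>q ^ m / z\<close> is again \<open>c\<close> times a
  power of \<open>q\<close>.\<close>

lemma theta_product:
  fixes q c :: "'a :: {real_normed_field, banach}"
  assumes "q \<noteq> 0" "norm q < 1" "0 < i" "i < m" "c * c = 1"
  shows "(\<Sum>\<^sub>\<infinity>n. (- c) powi n * q powi (int i * n + int m * tri n))
      = qpoch (c * q ^ i) (q ^ m) * qpoch (c * q ^ (m - i)) (q ^ m) * qpoch (q ^ m) (q ^ m)"
proof -
  have c: "norm c = 1" "c \<noteq> 0"
  proof -
    have "norm c ^ 2 = 1" using arg_cong[OF assms(5), of norm] by (simp add: norm_mult power2_eq_square)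
    then show "norm c = 1" by (metis norm_ge_zero one_power2 power2_eq_imp_eq zero_le_one)
    then show "c \<noteq> 0" by auto
  qed
  have "(\<lambda>n. (- c) powi n * q powi (int i * n + int m * tri n)) = jterm (c * q ^ i) (q ^ m)"
    using assms by (simp add: jterm_monomial fun_eq_iff)
  moreover have "norm (q ^ m) < norm (c * q ^ i)"
    using norm_power_less[OF assms(1,2,4)] c by (simp add: norm_mult)
  moreover have "norm (c * q ^ i) < 1"
    using assms c by (simp add: norm_mult norm_power power_less_one_iff)
  moreover have "q ^ m / (c * q ^ i) = c * q ^ (m - i)"
  proof -
    have "q ^ m = q ^ i * q ^ (m - i)" using assms by (simp flip: power_add)
    then show ?thesis using assms c by (simp add: field_simps mult.assoc[symmetric])
  qed
  ultimately show ?thesis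
    using jacobi_triple_product[of "q ^ m" "c * q ^ i"] assms(1) by (simp add: jtheta_def)
qed

lemma prod_lessThan_3: "(\<Prod>i<3. f i) = f 0 * f 1 * f (2 :: nat)"
  and prod_lessThan_5: "(\<Prod>i<5. f i) = f 0 * f 1 * f 2 * f 3 * f (4 :: nat)"
  for f :: "nat \<Rightarrow> 'a :: comm_monoid_mult"
  by (simp_all add: eval_nat_numeral mult.assoc)

text \<open>Sorting the factors modulo 3 exhibits Euler's product as a triple product with base
  \<open>x ^ 3\<close>. The exponent is \<open>n * (3 * n - 1) / 2\<close>.\<close>

lemma pentagonal_number_theorem:
  fixes x :: "'a :: {real_normed_field, banach}"
  assumes "x \<noteq> 0" "norm x < 1"
  shows "qpoch x x = (\<Sum>\<^sub>\<infinity>n. (-1) powi n * x powi (n + 3 * tri n))"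
proof -
  have "qpoch x x = (\<Prod>i<3. qpoch (x * x ^ i) (x ^ 3))"
    by (rule qpoch_dissect) (use assms in auto)
  also have "\<dots> = qpoch (1 * x ^ 1) (x ^ 3) * qpoch (1 * x ^ (3 - 1)) (x ^ 3) * qpoch (x ^ 3) (x ^ 3)"
    by (simp add: prod_lessThan_3 power2_eq_square power3_eq_cube mult.assoc)
  also have "\<dots> = (\<Sum>\<^sub>\<infinity>n. (- 1) powi n * x powi (int 1 * n + int 3 * tri n))"
    by (rule theta_product[symmetric]) (use assms in auto)
  finally show ?thesis by simp
qed

section \<open>The two theta series whose quotient is the continued fraction\<close>

definition rr_num :: "real \<Rightarrow> real" where
  "rr_num q = (\<Sum>\<^sub>\<infinity>n. (-1) powi n * q powi (n + 5 * tri n))"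

definition rr_den :: "real \<Rightarrow> real" where
  "rr_den q = (\<Sum>\<^sub>\<infinity>n. (-1) powi n * q powi (2 * n + 5 * tri n))"

lemma rr_num_product:
  assumes "0 < q" "q < 1"
  shows "rr_num q = qpoch q (q ^ 5) * qpoch (q ^ 4) (q ^ 5) * qpoch (q ^ 5) (q ^ 5)"
  using theta_product[of q 1 5 1] assms by (simp add: rr_num_def)

lemma rr_den_product:
  assumes "0 < q" "q < 1"
  shows "rr_den q = qpoch (q ^ 2) (q ^ 5) * qpoch (q ^ 3) (q ^ 5) * qpoch (q ^ 5) (q ^ 5)"
  using theta_product[of q 2 5 1] assms by (simp add: rr_den_def)

lemma power_bounds:
  fixes q :: real
  assumes "0 < q" "q < 1" "i > 0"
  shows "\<bar>q ^ i\<bar> < 1" "0 \<le> q ^ i" "q ^ i < 1" "0 < q ^ i"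
  using assms by (auto simp: power_less_one_iff)

lemma rr_num_pos: "0 < q \<Longrightarrow> q < 1 \<Longrightarrow> rr_num q > 0"
  and rr_den_pos: "0 < q \<Longrightarrow> q < 1 \<Longrightarrow> rr_den q > 0"
  unfolding rr_num_product rr_den_product
  by (intro mult_pos_pos qpoch_pos power_bounds; simp)+

text \<open>The two products cover the residues 1, 4 and 2, 3 modulo 5. Each also contains
  \<open>qpoch (q ^ 5) (q ^ 5)\<close>: one copy supplies residue 0 and the other remains.\<close>

lemma rr_num_times_rr_den:
  assumes "0 < q" "q < 1"
  shows "rr_num q * rr_den q = qpoch q q * qpoch (q ^ 5) (q ^ 5)"
proof -
  have "qpoch q q = (\<Prod>i<5. qpoch (q * q ^ i) (q ^ 5))"
    by (rule qpoch_dissect) (use assms in auto)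
  moreover have "q * q ^ 0 = q" "q * q ^ 1 = q ^ 2" "q * q ^ 2 = q ^ 3" "q * q ^ 3 = q ^ 4" "q * q ^ 4 = q ^ 5"
    by (simp_all add: eval_nat_numeral)
  ultimately show ?thesis
    using assms by (simp only: rr_num_product rr_den_product prod_lessThan_5) (simp only: mult_ac)
qed

text \<open>The product of the two theta series is grouped by the total power \<open>s\<close> of
  \<open>z\<close>, collected in \<open>G s\<close>. Modulo 3, two classes of \<open>s\<close>
  produce Euler's series in base \<open>q^2\<close>, and the third cancels.\<close>

lemma quintuple_product:
  fixes q z :: real
  assumes "0 < q" "q < z\<^sup>2" "\<bar>z\<bar> < 1"
  shows "jtheta z q * jtheta (q * z\<^sup>2) (q\<^sup>2) = qpoch (q\<^sup>2) (q\<^sup>2) *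
    ((\<Sum>\<^sub>\<infinity>k. z powi (3 * k) * q powi (k + 3 * tri k)) - (\<Sum>\<^sub>\<infinity>k. z powi (3 * k + 1) * q powi (2 * k + 3 * tri k)))"
proof -
  have z: "z \<noteq> 0" using assms by auto
  have z2: "z\<^sup>2 \<le> \<bar>z\<bar>" using assms mult_left_le[of "\<bar>z\<bar>" "\<bar>z\<bar>"] by (simp add: power2_eq_square flip: abs_mult)
  have "q < 1" using assms z2 by linarith
  have q2: "q\<^sup>2 < q * z\<^sup>2" "q * z\<^sup>2 < 1"
    using assms z2 mult_strict_mono[of q 1 "z\<^sup>2" 1] \<open>q < 1\<close> by (auto simp: power2_eq_square[of q])
  define G where "G s = (\<Sum>\<^sub>\<infinity>n. jterm z q (s - 2 * n) * jterm (q * z\<^sup>2) (q\<^sup>2) n)" for s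
  have bij: "bij (\<lambda>(s, n). (s - 2 * n, n :: int))"
    by (rule bij_betwI[where g = "\<lambda>(m, n). (m + 2 * n, n)"]) auto
  have S: "abs_summable (jterm z q)" "abs_summable (jterm (q * z\<^sup>2) (q\<^sup>2))"
    using jterm_abs_summable[of q z] jterm_abs_summable[of "q\<^sup>2" "q * z\<^sup>2"] assms z2 q2 by auto
  note * = infsum_times_reindex[OF S bij, folded G_def]
  have term_eq: "jterm z q (s - 2 * n) * jterm (q * z\<^sup>2) (q\<^sup>2) n = (-1) powi n * (- z) powi s * q powi (tri (s - 2 * n) + n\<^sup>2)" for s n
  proof -
    have "jterm (q * z\<^sup>2) (q\<^sup>2) n = jterm (z\<^sup>2 * q ^ 1) (q\<^sup>2) n"
      by (simp add: mult.commute)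
    also have "\<dots> = (- (z\<^sup>2)) powi n * q powi (n + 2 * tri n)"
      using assms by (subst jterm_monomial) auto
    also have "n + 2 * tri n = n\<^sup>2"
      unfolding two_times_tri by (simp add: power2_eq_square algebra_simps)
    also have "(- (z\<^sup>2)) powi n = (-1) powi n * (- z) powi (2 * n)"
      by (simp add: power_int_minus_left[of "z\<^sup>2"] power_int_mult power_int_minus_left)
    finally show ?thesis
      using z assms(1) by (simp add: jterm_def power_int_add power_int_diff)
  qed
  \<comment> \<open>Moving \<open>n\<close> by \<open>k\<close> cancels the mixed term in
    \<open>k\<close> and \<open>n\<close>: the exponent becomes a part in \<open>k\<close> plus a
    part in \<open>n\<close>, so the inner sum no longer depends on \<open>k\<close> up to a
    factor.\<close>
  have shift: "G (3 * k + c) = (-1) powi k * (- z) powi (3 * k + c) *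
     (\<Sum>\<^sub>\<infinity>n. (-1) powi n * q powi (tri (k + c - 2 * n) + (k + n)\<^sup>2))" for k c
  proof -
    have "G (3 * k + c) = (\<Sum>\<^sub>\<infinity>n. (-1) powi (n + k) * (- z) powi (3 * k + c) * q powi (tri (3 * k + c - 2 * (n + k)) + (n + k)\<^sup>2))"
      unfolding G_def term_eq by (rule infsum_int_shift[symmetric])
    also have "\<dots> = (\<Sum>\<^sub>\<infinity>n. ((-1) powi k * (- z) powi (3 * k + c)) * ((-1) powi n * q powi (tri (k + c - 2 * n) + (k + n)\<^sup>2)))"
      by (rule infsum_cong) (simp add: power_int_add algebra_simps)
    finally show ?thesis by (simp add: infsum_cmult_right')
  qed
  have f: "qpoch (q\<^sup>2) (q\<^sup>2) = (\<Sum>\<^sub>\<infinity>n. (-1) powi n * q powi (2 * n + 6 * tri n))"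
  proof -
    have "qpoch (q\<^sup>2) (q\<^sup>2) = (\<Sum>\<^sub>\<infinity>n. (-1) powi n * (q\<^sup>2) powi (n + 3 * tri n))"
      using assms \<open>q < 1\<close> by (intro pentagonal_number_theorem) (auto simp: power_less_one_iff)
    then show ?thesis by (simp add: power_int_power algebra_simps)
  qed
  have f': "qpoch (q\<^sup>2) (q\<^sup>2) = (\<Sum>\<^sub>\<infinity>n. (-1) powi n * q powi (4 * n + 6 * tri n))"
    using infsum_int_reflect[of "\<lambda>n. (-1) powi n * q powi (2 * n + 6 * tri n)" 0]
    by (simp add: f tri_minus power_int_minus_one_minus algebra_simps)
  have pull: "(\<Sum>\<^sub>\<infinity>n. (-1) powi n * q powi (a + b n)) = q powi a * (\<Sum>\<^sub>\<infinity>n. (-1) powi n * q powi b n)" for a and b :: "int \<Rightarrow> int"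
    using assms(1) by (simp add: power_int_add mult.left_commute flip: infsum_cmult_right')
  have G0: "G (3 * k) = z powi (3 * k) * q powi (k + 3 * tri k) * qpoch (q\<^sup>2) (q\<^sup>2)" for k
  proof -
    have "tri (k - 2 * n) + (k + n)\<^sup>2 = (k + 3 * tri k) + (4 * n + 6 * tri n)" for n
      using two_times_tri[of "k - 2 * n"] two_times_tri[of k] two_times_tri[of n]
      by (simp add: algebra_simps power2_eq_square)
    moreover have "(-1) powi k * (- z) powi (3 * k) = z powi (3 * k)"
      by (cases "even k") (auto simp: power_int_minus_left)
    moreover have "(\<Sum>\<^sub>\<infinity>n. (-1) powi n * q powi ((k + 3 * tri k) + (4 * n + 6 * tri n)))
        = q powi (k + 3 * tri k) * qpoch (q\<^sup>2) (q\<^sup>2)"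
      unfolding f' by (rule pull)
    ultimately show ?thesis
      using shift[of k 0] by simp
  qed
  have G1: "G (3 * k + 1) = - (z powi (3 * k + 1) * q powi (2 * k + 3 * tri k)) * qpoch (q\<^sup>2) (q\<^sup>2)" for k
  proof -
    have "tri (k + 1 - 2 * n) + (k + n)\<^sup>2 = (2 * k + 3 * tri k) + (2 * n + 6 * tri n)" for n
      using two_times_tri[of "k + 1 - 2 * n"] two_times_tri[of k] two_times_tri[of n]
      by (simp add: algebra_simps power2_eq_square)
    moreover have "(-1) powi k * (- z) powi (3 * k + 1) = - (z powi (3 * k + 1))"
      by (cases "even k") (auto simp: power_int_minus_left)
    moreover have "(\<Sum>\<^sub>\<infinity>n. (-1) powi n * q powi ((2 * k + 3 * tri k) + (2 * n + 6 * tri n)))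
        = q powi (2 * k + 3 * tri k) * qpoch (q\<^sup>2) (q\<^sup>2)"
      unfolding f by (rule pull)
    ultimately show ?thesis
      using shift[of k 1] by simp
  qed
  have G2: "G (3 * k + 2) = 0" for k
  proof -
    define F where "F n = (-1) powi n * q powi (tri (k + 2 - 2 * n) + (k + n)\<^sup>2)" for n
    \<comment> \<open>The reflection \<open>n\<close> to \<open>1 - n\<close> preserves the exponent
      and flips the sign, so the third class sums to zero.\<close>
    have "F (1 - n) = - F n" for n
    proof -
      have "tri (k + 2 - 2 * (1 - n)) + (k + (1 - n))\<^sup>2 = tri (k + 2 - 2 * n) + (k + n)\<^sup>2"
        using two_times_tri[of "k + 2 - 2 * n"] two_times_tri[of "k + 2 - 2 * (1 - n)"]
        by (simp add: algebra_simps power2_eq_square)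
      moreover have "(-1) powi (1 - n) = - ((-1) powi n :: real)"
        by (cases "even n") auto
      ultimately show ?thesis unfolding F_def by simp
    qed
    then have "infsum F UNIV = - infsum F UNIV"
      using infsum_int_reflect[of F 1] by (simp add: infsum_uminus)
    then have "infsum F UNIV = 0" by simp
    then show ?thesis using shift[of k 2] unfolding F_def by simp
  qed
  have "{0..<3 :: int} = {0, 1, 2}" by auto
  then have "jtheta z q * jtheta (q * z\<^sup>2) (q\<^sup>2) = (\<Sum>\<^sub>\<infinity>k. G (3 * k)) + (\<Sum>\<^sub>\<infinity>k. G (3 * k + 1)) + (\<Sum>\<^sub>\<infinity>k. G (3 * k + 2))"
    using *(1) infsum_int_residue[OF *(2), of 3] by (simp add: jtheta_def)
  then show ?thesis
    unfolding G0 G1 G2 mult_minus_left infsum_uminus infsum_cmult_left' by (simp add: algebra_simps)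
qed

subsection \<open>The five-dissection of Euler's product\<close>

lemma qpoch_of_real:
  assumes "\<bar>q\<bar> < 1"
  shows "qpoch (of_real a) (of_real q) = (of_real (qpoch a q) :: complex)"
proof (rule LIMSEQ_unique[OF qpoch_LIMSEQ])
  show "(\<lambda>n. \<Prod>k<n. 1 - complex_of_real a * of_real q ^ k) \<longlonglongrightarrow> of_real (qpoch a q)"
    using tendsto_of_real[OF qpoch_LIMSEQ[of q a], where ?'a = complex] assms by (simp add: of_real_prod)
qed (use assms in auto)

text \<open>Taking real parts shows that both families are summable or neither is; in the latter
  case both sums have the default value 0. Hence no summability hypothesis.\<close>

lemma infsum_complex_of_real: "(\<Sum>\<^sub>\<infinity>x\<in>A. complex_of_real (f x)) = of_real (\<Sum>\<^sub>\<infinity>x\<in>A. f x)"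
proof (rule infsum_bounded_linear_strong)
  have "f summable_on A" if "(\<lambda>x. complex_of_real (f x)) summable_on A"
    using summable_on_bounded_linear[OF bounded_linear_Re that] by simp
  then show "(\<lambda>x. complex_of_real (f x)) summable_on A \<longleftrightarrow> f summable_on A"
    using summable_on_of_real by blast
qed (rule bounded_linear_of_real)

text \<open>The quintuple product in base \<open>q ^ 5\<close> at \<open>z = - (q ^ i)\<close>. The
  minus sign turns the difference of the two series into a sum and creates the alternating signs.
  The common factor \<open>qpoch (q ^ 10) (q ^ 10)\<close> is positive and cancels.\<close>

lemma quintuple_monomial:
  fixes q :: real
  assumes q: "0 < q" "q < 1" and i: "0 < i" "i < 3"
  shows "(\<Sum>\<^sub>\<infinity>k. (-1) powi k * q powi ((3 * int i + 5) * k + 15 * tri k))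
       + q ^ i * (\<Sum>\<^sub>\<infinity>k. (-1) powi k * q powi ((3 * int i + 10) * k + 15 * tri k))
      = qpoch (- (q ^ i)) (q ^ 5) * qpoch (- (q ^ (5 - i))) (q ^ 5) * qpoch (q ^ 5) (q ^ 5)
        * qpoch (q ^ (5 + 2 * i)) (q ^ 10) * qpoch (q ^ (5 - 2 * i)) (q ^ 10)"
    (is "?S1 + _ * ?S2 = ?P * ?f * ?R1 * ?R2")
proof -
  define Q where "Q = q ^ 5"
  define z where "z = - (q ^ i)"
  have Q: "0 < Q" "Q < 1" using q by (auto simp: Q_def power_less_one_iff)
  have z: "Q < z\<^sup>2" "\<bar>z\<bar> < 1"
    using q i by (auto simp: Q_def z_def power_less_one_iff power_strict_decreasing simp flip: power_mult)
  have "jtheta z Q = qpoch z Q * qpoch (Q / z) Q * qpoch Q Q"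
    by (rule jacobi_triple_product) (use Q z q i power_strict_decreasing[of i 5 q] in \<open>auto simp: z_def Q_def\<close>)
  moreover have "Q / z = - (q ^ (5 - i))"
    using q i by (simp add: Q_def z_def field_simps flip: power_add)
  ultimately have J1: "jtheta z Q = ?P * ?f" by (simp add: Q_def z_def)
  have "jtheta (Q * z\<^sup>2) (Q\<^sup>2) = qpoch (Q * z\<^sup>2) (Q\<^sup>2) * qpoch (Q\<^sup>2 / (Q * z\<^sup>2)) (Q\<^sup>2) * qpoch (Q\<^sup>2) (Q\<^sup>2)"
  proof (rule jacobi_triple_product)
    have "Q * z\<^sup>2 = q ^ (5 + 2 * i)" "Q\<^sup>2 = q ^ 10"
      by (simp add: Q_def z_def power_add power_even_eq, simp add: Q_def flip: power_mult)
    then show "norm (Q\<^sup>2) < norm (Q * z\<^sup>2)" "norm (Q * z\<^sup>2) < 1" "Q\<^sup>2 \<noteq> 0"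
      using q i by (auto simp: power_strict_decreasing power_less_one_iff)
  qed
  moreover have "Q * z\<^sup>2 = q ^ (5 + 2 * i)" "Q\<^sup>2 = q ^ 10"
    by (simp add: Q_def z_def power_add power_even_eq, simp add: Q_def flip: power_mult)
  moreover have "q ^ 10 / q ^ (5 + 2 * i) = q ^ (5 - 2 * i)"
    using q i by (simp add: field_simps flip: power_add)
  ultimately have J2: "jtheta (Q * z\<^sup>2) (Q\<^sup>2) = ?R1 * ?R2 * qpoch (Q\<^sup>2) (Q\<^sup>2)" by simp
  have zp: "z powi n = (-1) powi n * q powi (int i * n)" for n
    by (simp add: z_def power_int_minus_left[of "q ^ i"] power_int_minus_left[of 1] power_int_power)
  have Qp: "Q powi n = q powi (5 * n)" for n
    by (simp add: Q_def power_int_power)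
  have S1: "(\<Sum>\<^sub>\<infinity>k. z powi (3 * k) * Q powi (k + 3 * tri k)) = ?S1"
  proof (rule infsum_cong)
    fix k :: int
    have "int i * (3 * k) + 5 * (k + 3 * tri k) = (3 * int i + 5) * k + 15 * tri k"
      by (simp add: algebra_simps)
    then have "q powi (int i * (3 * k)) * q powi (5 * (k + 3 * tri k)) = q powi ((3 * int i + 5) * k + 15 * tri k)"
      using q by (metis power_int_add less_irrefl)
    then show "z powi (3 * k) * Q powi (k + 3 * tri k) = (-1) powi k * q powi ((3 * int i + 5) * k + 15 * tri k)"
      by (cases "even k") (simp_all add: zp Qp)
  qed
  have S2: "(\<Sum>\<^sub>\<infinity>k. z powi (3 * k + 1) * Q powi (2 * k + 3 * tri k)) = - (q ^ i * ?S2)"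
  proof -
    have "z powi (3 * k + 1) * Q powi (2 * k + 3 * tri k) = - (q ^ i * ((-1) powi k * q powi ((3 * int i + 10) * k + 15 * tri k)))" for k
    proof -
      have "int i * (3 * k + 1) + 5 * (2 * k + 3 * tri k) = int i + ((3 * int i + 10) * k + 15 * tri k)"
        by (simp add: algebra_simps)
      then have "q powi (int i * (3 * k + 1)) * q powi (5 * (2 * k + 3 * tri k)) = q ^ i * q powi ((3 * int i + 10) * k + 15 * tri k)"
        using q by (metis power_int_add power_int_of_nat less_irrefl)
      then show ?thesis
        by (cases "even k") (simp_all add: zp Qp)
    qed
    then show ?thesis by (simp add: infsum_cmult_right' infsum_uminus)
  qed
  have "qpoch (Q\<^sup>2) (Q\<^sup>2) > 0"
    using Q by (intro qpoch_pos) (auto simp: power_less_one_iff)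
  moreover have "qpoch (Q\<^sup>2) (Q\<^sup>2) * (?S1 + q ^ i * ?S2) = qpoch (Q\<^sup>2) (Q\<^sup>2) * (?P * ?f * ?R1 * ?R2)"
    using quintuple_product[OF Q(1) z] unfolding S1 S2 J1 J2 by (auto simp: mult_ac)
  ultimately show ?thesis by simp
qed

text \<open>\<open>dis0 q\<close> and \<open>- x\<^sup>2 dis2 q\<close> collect the terms of the pentagonal number series of \<open>f(-x)\<close>, \<open>x\<^sup>5 = q\<close>,
  whose exponents are congruent to 0 and 2 modulo 5.\<close>

definition dis0 :: "real \<Rightarrow> real" where
  "dis0 q = (\<Sum>\<^sub>\<infinity>k. (-1) powi k * q powi (8 * k + 15 * tri k)) + q * (\<Sum>\<^sub>\<infinity>k. (-1) powi k * q powi (13 * k + 15 * tri k))"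

definition dis2 :: "real \<Rightarrow> real" where
  "dis2 q = (\<Sum>\<^sub>\<infinity>k. (-1) powi k * q powi (11 * k + 15 * tri k)) + q\<^sup>2 * (\<Sum>\<^sub>\<infinity>k. (-1) powi k * q powi (16 * k + 15 * tri k))"

lemma qpoch_even_odd:
  fixes a q :: real
  assumes "0 < q" "q < 1"
  shows "qpoch a (q ^ 5) = qpoch a (q ^ 10) * qpoch (a * q ^ 5) (q ^ 10)"
  using qpoch_dissect[of "q ^ 5" 2 a] assms
  by (simp add: eval_nat_numeral power_less_one_iff del: power_Suc flip: power_mult power_Suc)

lemma qpoch_minus_even:
  fixes a q :: real
  assumes "0 < q" "q < 1"
  shows "qpoch a (q ^ 5) * qpoch (- a) (q ^ 5) = qpoch (a\<^sup>2) (q ^ 10)"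
  using qpoch_times_minus[of "q ^ 5" a] assms by (simp add: power_less_one_iff flip: power_mult)

text \<open>Factors at \<open>q\<close> and \<open>q ^ 4\<close> meet those at \<open>- q\<close>
  and \<open>- (q ^ 4)\<close> from the quintuple product and become \<open>q ^ 2\<close> and
  \<open>q ^ 8\<close> in base \<open>q ^ 10\<close>. Together with \<open>q ^ 7\<close> and
  \<open>q ^ 3\<close> they reassemble the residues 2 and 3 in base \<open>q ^ 5\<close>. In
  \<open>dis2_eq\<close> the roles of the two pairs of residues are exchanged.\<close>

lemma dis0_eq:
  assumes q: "0 < q" "q < 1"
  shows "dis0 q * rr_num q = qpoch (q ^ 5) (q ^ 5) * rr_den q"
proof -
  have "dis0 q * rr_num q = (qpoch q (q ^ 5) * qpoch (- q) (q ^ 5)) * (qpoch (q ^ 4) (q ^ 5) * qpoch (- (q ^ 4)) (q ^ 5))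
      * qpoch (q ^ 7) (q ^ 10) * qpoch (q ^ 3) (q ^ 10) * qpoch (q ^ 5) (q ^ 5) * qpoch (q ^ 5) (q ^ 5)"
    using quintuple_monomial[OF q, of 1] by (simp add: dis0_def rr_num_product[OF q] mult_ac)
  also have "\<dots> = (qpoch (q ^ 2) (q ^ 10) * qpoch (q ^ 7) (q ^ 10)) * (qpoch (q ^ 3) (q ^ 10) * qpoch (q ^ 8) (q ^ 10)) * qpoch (q ^ 5) (q ^ 5) * qpoch (q ^ 5) (q ^ 5)"
    unfolding qpoch_minus_even[OF q] by (simp flip: power_mult)
  also have "\<dots> = qpoch (q ^ 5) (q ^ 5) * rr_den q"
    using qpoch_even_odd[OF q, of "q ^ 2"] qpoch_even_odd[OF q, of "q ^ 3"]
    by (simp add: rr_den_product[OF q] flip: power_add)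
  finally show ?thesis .
qed

lemma dis2_eq:
  assumes q: "0 < q" "q < 1"
  shows "dis2 q * rr_den q = qpoch (q ^ 5) (q ^ 5) * rr_num q"
proof -
  have "dis2 q * rr_den q = (qpoch (q ^ 2) (q ^ 5) * qpoch (- (q ^ 2)) (q ^ 5)) * (qpoch (q ^ 3) (q ^ 5) * qpoch (- (q ^ 3)) (q ^ 5))
      * qpoch (q ^ 9) (q ^ 10) * qpoch q (q ^ 10) * qpoch (q ^ 5) (q ^ 5) * qpoch (q ^ 5) (q ^ 5)"
    using quintuple_monomial[OF q, of 2] by (simp add: dis2_def rr_den_product[OF q] mult_ac)
  also have "\<dots> = (qpoch q (q ^ 10) * qpoch (q ^ 6) (q ^ 10)) * (qpoch (q ^ 4) (q ^ 10) * qpoch (q ^ 9) (q ^ 10)) * qpoch (q ^ 5) (q ^ 5) * qpoch (q ^ 5) (q ^ 5)"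
    unfolding qpoch_minus_even[OF q] by (simp flip: power_mult)
  also have "\<dots> = qpoch (q ^ 5) (q ^ 5) * rr_num q"
    using qpoch_even_odd[OF q, of q] qpoch_even_odd[OF q, of "q ^ 4"]
    by (simp add: rr_num_product[OF q] flip: power_add power_Suc)
  finally show ?thesis .
qed

text \<open>The pentagonal numbers of index 0, 1, 2, 3, 4 are 0, 1, 5, 12, 22, so only the residues
  0, 1, 2 modulo 5 occur among the exponents of \<open>x\<close>, and two of them twice.\<close>

lemma qpoch_five_dissection:
  assumes q: "0 < q" "q < 1" and x: "x ^ 5 = complex_of_real q"
  shows "qpoch x x = of_real (dis0 q) - x * of_real (qpoch (q ^ 5) (q ^ 5)) - x\<^sup>2 * of_real (dis2 q)"
proof -
  have nx: "norm x ^ 5 = q" using arg_cong[OF x, of norm] q by (simp add: norm_power)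
  have x0: "x \<noteq> 0" using x q by auto
  have x1: "norm x < 1"
    using nx q power_le_one_iff[of "norm x" 5] one_le_power[of "norm x" 5] by (meson leI linorder_not_less norm_ge_zero)
  define t where "t n = (-1) powi n * x powi (n + 3 * tri n)" for n
  have "abs_summable (\<lambda>n. jterm x (x ^ 3) n)"
    using x0 x1 norm_power_less[OF x0 x1, of 1 3] by (intro jterm_abs_summable) auto
  moreover have "jterm x (x ^ 3) = t"
    using jterm_monomial[OF x0, of 1 1 3] by (auto simp: t_def fun_eq_iff)
  ultimately have St: "t summable_on UNIV" by (simp add: abs_summable_summable)
  define S where "S c = (\<Sum>\<^sub>\<infinity>k. (-1) powi k * q powi (c * k + 15 * tri k))" for c
  \<comment> \<open>The exponent at index \<open>5 * k + r\<close> is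
    \<open>5 * (c * k + 15 * tri k) + d\<close>, where \<open>d\<close> is the pentagonal number of
    \<open>r\<close>; expanding the square gives \<open>c = 3 * r + 7\<close>.\<close>
  have cls: "(\<Sum>\<^sub>\<infinity>k. t (5 * k + r)) = (-1) powi r * x ^ d * of_real (S c)"
    if "int d = r + 3 * tri r" "c = 3 * r + 7" for r c d
  proof -
    have "t (5 * k + r) = (-1) powi r * x ^ d * of_real ((-1) powi k * q powi (c * k + 15 * tri k))" for k
    proof -
      have "5 * k + r + 3 * tri (5 * k + r) = 5 * (c * k + 15 * tri k) + int d"
        using that two_times_tri[of "5 * k + r"] two_times_tri[of k] two_times_tri[of r]
        by (simp add: algebra_simps)
      moreover have "x powi (5 * (c * k + 15 * tri k)) = of_real (q powi (c * k + 15 * tri k))"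
        using power_int_power[of x 5 "c * k + 15 * tri k"] x by simp
      moreover have "(-1) powi (5 * k + r) = (-1) powi r * ((-1) powi k :: complex)"
        by (cases "even k") (simp_all add: power_int_add)
      moreover have "x powi (5 * (c * k + 15 * tri k) + int d) = x powi (5 * (c * k + 15 * tri k)) * x ^ d"
        using x0 by (simp only: power_int_add power_int_of_nat simp_thms)
      ultimately show ?thesis
        by (simp only: t_def of_real_mult of_real_power_int of_real_minus of_real_1 mult_ac)
    qed
    then show ?thesis
      by (simp add: S_def infsum_cmult_right' infsum_complex_of_real del: of_real_mult)
  qed
  have refl: "S c = S (15 - c)" for c
    using infsum_int_reflect[of "\<lambda>k. (-1) powi k * q powi (c * k + 15 * tri k)" 0]
    by (simp add: S_def tri_minus power_int_minus_one_minus algebra_simps)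
  have sh: "S c = - (q powi c) * S (c + 15)" for c
  proof -
    have "S c = (\<Sum>\<^sub>\<infinity>k. - (q powi c) * ((-1) powi k * q powi ((c + 15) * k + 15 * tri k)))"
      unfolding S_def
    proof (subst infsum_int_shift[of _ 1, symmetric], rule infsum_cong)
      fix k :: int
      have "c * (k + 1) + 15 * tri (k + 1) = c + ((c + 15) * k + 15 * tri k)"
        unfolding tri_add_1 by (simp add: algebra_simps)
      then show "(-1) powi (k + 1) * q powi (c * (k + 1) + 15 * tri (k + 1)) = - (q powi c) * ((-1) powi k * q powi ((c + 15) * k + 15 * tri k))"
        using q by (simp only: power_int_add) (simp add: power_int_add)
    qed
    then show ?thesis by (simp only: S_def infsum_cmult_right')
  qed
  \<comment> \<open>The class of \<open>r = 1\<close> is Euler's series again, now at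
    \<open>q ^ 5\<close>, because \<open>5 * k + 15 * tri k\<close> is five times a pentagonal
    number. The reflection \<open>refl\<close> identifies it with \<open>S 10\<close>.\<close>
  have "S 5 = qpoch (q ^ 5) (q ^ 5)"
    using pentagonal_number_theorem[of "q ^ 5"] q
    by (simp add: S_def power_less_one_iff power_int_power algebra_simps)
  then have S10: "S 10 = qpoch (q ^ 5) (q ^ 5)" using refl[of 10] by simp
  have S8: "dis0 q = S 7 + q * S 13" using refl[of 8] by (simp add: dis0_def S_def)
  have S11: "dis2 q = q\<^sup>2 * S 16 - q ^ 4 * S 19" using refl[of 11] sh[of 4] by (simp add: dis2_def S_def)
  have "{0..<5 :: int} = {0, 1, 2, 3, 4}" by auto
  then have "(\<Sum>\<^sub>\<infinity>n. t n) = of_real (S 7) - x * of_real (S 10) + x ^ 5 * of_real (S 13)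
      - x ^ 12 * of_real (S 16) + x ^ 22 * of_real (S 19)"
    using infsum_int_residue[OF St, of 5] cls[of 0 0 7] cls[of 1 1 10] cls[of 5 2 13] cls[of 12 3 16] cls[of 22 4 19]
    by (simp add: tri_def)
  moreover have "x ^ 12 = x\<^sup>2 * of_real (q\<^sup>2)" "x ^ 22 = x\<^sup>2 * of_real (q ^ 4)"
    by (simp_all flip: x power_mult power_add)
  ultimately have "(\<Sum>\<^sub>\<infinity>n. t n) = of_real (dis0 q) - x * of_real (qpoch (q ^ 5) (q ^ 5)) - x\<^sup>2 * of_real (dis2 q)"
    by (simp add: x S8 S10 S11 algebra_simps)
  then show ?thesis
    using pentagonal_number_theorem[OF x0 x1] by (simp add: t_def)
qed

section \<open>Multiplication over the five fifth roots\<close>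

lemma fifth_root_product:
  fixes w y :: complex
  assumes "1 + w + w\<^sup>2 + w ^ 3 + w ^ 4 = 0"
  shows "(1 - y) * (1 - w * y) * (1 - w\<^sup>2 * y) * (1 - w ^ 3 * y) * (1 - w ^ 4 * y) = 1 - y ^ 5"
  using assms by algebra

text \<open>With \<open>b = a * r\<close> and \<open>c = a * r^2\<close>, each factor is
  \<open>a\<close> times a value of \<open>1 - x - x^2\<close>, and the golden-ratio splitting
  explains the 11. The proof itself pairs complex conjugate factors: their coefficients involve only
  the two Gaussian periods \<open>s\<close> and \<open>t\<close>, the roots of
  \<open>X^2 + X - 1\<close>.\<close>

lemma fifth_root_norm:
  fixes w a b c :: complex
  assumes w: "1 + w + w\<^sup>2 + w ^ 3 + w ^ 4 = 0" and abc: "a * c = b\<^sup>2"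
  shows "(a - b - c) * (a - w * b - w\<^sup>2 * c) * (a - w\<^sup>2 * b - w ^ 4 * c) * (a - w ^ 3 * b - w ^ 6 * c) * (a - w ^ 4 * b - w ^ 8 * c)
    = a ^ 5 - 11 * b ^ 5 - c ^ 5"
proof -
  define s where "s = w + w ^ 4"
  define t where "t = w\<^sup>2 + w ^ 3"
  have st: "t = - 1 - s" "s\<^sup>2 = 1 - s" using w unfolding s_def t_def by algebra+
  have 1: "(a - w * b - w\<^sup>2 * c) * (a - w ^ 4 * b - w ^ 8 * c) = a\<^sup>2 + b\<^sup>2 + c\<^sup>2 - s * (a * b - b * c) - t * (a * c)"
    using w unfolding s_def t_def by algebra
  have 2: "(a - w\<^sup>2 * b - w ^ 4 * c) * (a - w ^ 3 * b - w ^ 6 * c) = a\<^sup>2 + b\<^sup>2 + c\<^sup>2 - t * (a * b - b * c) - s * (a * c)"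
    using w unfolding s_def t_def by algebra
  have "(a - b - c) * ((a - w * b - w\<^sup>2 * c) * (a - w ^ 4 * b - w ^ 8 * c)) * ((a - w\<^sup>2 * b - w ^ 4 * c) * (a - w ^ 3 * b - w ^ 6 * c))
     = a ^ 5 - 11 * b ^ 5 - c ^ 5"
    unfolding 1 2 st(1) using st(2) abc by algebra
  then show ?thesis by (simp add: mult_ac)
qed

lemma primitive_fifth_root:
  obtains w :: complex where "\<And>i. i \<in> {1, 2, 3, 4} \<Longrightarrow> 1 + w ^ i + (w ^ i)\<^sup>2 + (w ^ i) ^ 3 + (w ^ i) ^ 4 = 0" "w ^ 5 = 1"
proof
  define w where "w = cis (2 * pi / 5)"
  show 5: "w ^ 5 = 1" by (simp add: w_def Complex.DeMoivre flip: cis_2pi)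
  have "w \<noteq> 1"
  proof
    assume "w = 1"
    then have "cos (2 * pi / 5) = 1" by (simp add: w_def complex_eq_iff)
    moreover have "cos (2 * pi / 5) < cos 0"
      by (rule cos_monotone_0_pi) auto
    ultimately show False by simp
  qed
  moreover have "(1 - w) * (1 + w + w\<^sup>2 + w ^ 3 + w ^ 4) = 0"
    using 5 by (simp add: algebra_simps eval_nat_numeral)
  ultimately have w: "1 + w + w\<^sup>2 + w ^ 3 + w ^ 4 = 0" by simp
  show "1 + w ^ i + (w ^ i)\<^sup>2 + (w ^ i) ^ 3 + (w ^ i) ^ 4 = 0" if i: "i \<in> {1, 2, 3, 4}" for i
  proof -
    consider "i = 1" | "i = 2" | "i = 3" | "i = 4" using i by auto
    then show ?thesis
    proof cases
      case 1
      then show ?thesis using w by simp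
    next
      case 2
      have "1 + w ^ 2 + (w ^ 2)\<^sup>2 + (w ^ 2) ^ 3 + (w ^ 2) ^ 4 = 0" using w by algebra
      then show ?thesis unfolding 2 .
    next
      case 3
      have "1 + w ^ 3 + (w ^ 3)\<^sup>2 + (w ^ 3) ^ 3 + (w ^ 3) ^ 4 = 0" using w by algebra
      then show ?thesis unfolding 3 .
    next
      case 4
      have "1 + w ^ 4 + (w ^ 4)\<^sup>2 + (w ^ 4) ^ 3 + (w ^ 4) ^ 4 = 0" using w by algebra
      then show ?thesis unfolding 4 .
    qed
  qed
qed

lemma qpoch_fifth_root_product:
  fixes w y q :: complex
  assumes q: "norm q < 1" and w: "1 + w + w\<^sup>2 + w ^ 3 + w ^ 4 = 0"
  shows "(\<Prod>j<5. qpoch (w ^ j * y) q) = qpoch (y ^ 5) (q ^ 5)"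
proof -
  have "(\<Prod>j<5. qpoch (w ^ j * y) q) = (\<Prod>n. \<Prod>j<5. 1 - w ^ j * y * q ^ n)"
    unfolding qpoch_def by (intro prodinf_prod[symmetric] convergent_prod_qpoch q)
  also have "(\<lambda>n. \<Prod>j<5. 1 - w ^ j * y * q ^ n) = (\<lambda>n. 1 - y ^ 5 * (q ^ 5) ^ n)"
  proof
    fix n
    show "(\<Prod>j<5. 1 - w ^ j * y * q ^ n) = 1 - y ^ 5 * (q ^ 5) ^ n"
      using fifth_root_product[OF w, of "y * q ^ n"]
      by (simp add: prod_lessThan_5 mult.assoc power_mult_distrib power_commutes flip: power_mult)
        (simp add: mult.commute)
  qed
  finally show ?thesis by (simp add: qpoch_def)
qed

text \<open>For \<open>x = w ^ j * p\<close> the dissection modulo 5 writes \<open>qpoch x x\<close>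
  as a product of five symbols with the common base \<open>Q\<close>, because
  \<open>x ^ 5 = Q\<close>. Exchanging the two products, the factors with \<open>x ^ Suc i\<close>
  and \<open>i < 4\<close> combine over \<open>j\<close> into base \<open>Q ^ 5\<close>, while
  \<open>i = 4\<close> gives five equal factors \<open>qpoch Q Q\<close>.\<close>

theorem rr_quotient_identity:
  fixes q :: real
  assumes q: "0 < q" "q < 1"
  defines "r \<equiv> rr_num q / rr_den q"
  shows "qpoch q q ^ 6 = qpoch (q ^ 5) (q ^ 5) ^ 6 * ((1 / r) ^ 5 - 11 * q - q\<^sup>2 * r ^ 5)"
proof -
  define f where "f = qpoch (q ^ 5) (q ^ 5)"
  define p where "p = complex_of_real (root 5 q)"
  define Q where "Q = complex_of_real q"
  have p: "p ^ 5 = Q"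
    using q by (simp add: p_def Q_def odd_real_root_pow flip: of_real_power)
  have nQ: "norm Q < 1" using q by (simp add: Q_def)
  have q5: "q ^ 5 < 1" using q by (simp add: power_less_one_iff)
  have f: "f > 0" unfolding f_def using q q5 by (intro qpoch_pos) auto
  have r: "r > 0" using rr_num_pos[OF q] rr_den_pos[OF q] by (simp add: r_def)
  have d: "dis0 q = f / r" "dis2 q = f * r"
    using dis0_eq[OF q] dis2_eq[OF q] rr_num_pos[OF q] rr_den_pos[OF q] by (simp_all add: r_def f_def field_simps)
  obtain w :: complex where w: "\<And>i. i \<in> {1, 2, 3, 4} \<Longrightarrow> 1 + w ^ i + (w ^ i)\<^sup>2 + (w ^ i) ^ 3 + (w ^ i) ^ 4 = 0" and w5: "w ^ 5 = 1"
    using primitive_fifth_root by blast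
  define a where "a = complex_of_real (f / r)"
  define b where "b = p * of_real f"
  define c where "c = p\<^sup>2 * of_real (f * r)"
  have x5: "(w ^ j * p) ^ 5 = Q" for j
    by (simp add: power_mult_distrib p w5 flip: power_mult) (simp add: power_mult w5 mult.commute[of j])
  have diss: "qpoch (w ^ j * p) (w ^ j * p) = a - w ^ j * b - w ^ (2 * j) * c" for j
    using qpoch_five_dissection[OF q, of "w ^ j * p"] x5[of j]
    unfolding power_even_eq[of w j]
    by (simp add: Q_def d f_def[symmetric] a_def b_def c_def power_mult_distrib mult_ac)
  have "(\<Prod>j<5. qpoch (w ^ j * p) (w ^ j * p)) = (\<Prod>j<5. \<Prod>i<5. qpoch ((w ^ j * p) * (w ^ j * p) ^ i) Q)"
  proof (rule prod.cong)
    fix j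
    have "norm (w ^ j * p) ^ 5 < 1" using arg_cong[OF x5[of j], of norm] nQ by (simp add: norm_power norm_mult)
    then have "norm (w ^ j * p) < 1" using one_le_power[of "norm (w ^ j * p)" 5] by (meson linorder_not_less)
    then show "qpoch (w ^ j * p) (w ^ j * p) = (\<Prod>i<5. qpoch ((w ^ j * p) * (w ^ j * p) ^ i) Q)"
      using qpoch_dissect[of "w ^ j * p" 5 "w ^ j * p"] x5[of j] by simp
  qed simp
  also have "\<dots> = (\<Prod>i<5. \<Prod>j<5. qpoch ((w ^ Suc i) ^ j * p ^ Suc i) Q)"
  proof -
    have K: "(w ^ j * p) * (w ^ j * p) ^ i = (w ^ Suc i) ^ j * p ^ Suc i" for i j
    proof -
      have "(w ^ j) ^ i = (w ^ i) ^ j" by (simp add: mult.commute flip: power_mult)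
      then show ?thesis by (simp add: power_mult_distrib)
    qed
    show ?thesis by (subst prod.swap) (simp only: K)
  qed
  also have "\<dots> = qpoch Q (Q ^ 5) * qpoch (Q ^ 2) (Q ^ 5) * qpoch (Q ^ 3) (Q ^ 5) * qpoch (Q ^ 4) (Q ^ 5) * qpoch Q Q ^ 5"
  proof -
    have "(\<Prod>j<5. qpoch ((w ^ Suc i) ^ j * p ^ Suc i) Q) = qpoch (Q ^ Suc i) (Q ^ 5)" if "i < 4" for i
    proof -
      have "Suc i \<in> {1, 2, 3, 4}" using that by auto
      from qpoch_fifth_root_product[OF nQ w[OF this]] show ?thesis
        by (simp only: p[symmetric] flip: power_mult) (simp only: mult.commute)
    qed
    from this[of 0] this[of 1] this[of 2] this[of 3] show ?thesis
      by (simp add: prod_lessThan_5[of "\<lambda>i. \<Prod>j<5. qpoch ((w ^ Suc i) ^ j * p ^ Suc i) Q"] del: power_Suc)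
        (simp add: w5 p numeral_2_eq_2 numeral_3_eq_3 del: power_Suc)
  qed
  \<comment> \<open>Residue 0 modulo 5 is missing from the product; multiplying by
    \<open>qpoch (Q ^ 5) (Q ^ 5)\<close> supplies it and completes a sixth factor
    \<open>qpoch Q Q\<close>.\<close>
  finally have P: "(\<Prod>j<5. qpoch (w ^ j * p) (w ^ j * p)) * qpoch (Q ^ 5) (Q ^ 5) = qpoch Q Q ^ 6"
  proof -
    assume *: "(\<Prod>j<5. qpoch (w ^ j * p) (w ^ j * p)) = qpoch Q (Q ^ 5) * qpoch (Q ^ 2) (Q ^ 5) * qpoch (Q ^ 3) (Q ^ 5) * qpoch (Q ^ 4) (Q ^ 5) * qpoch Q Q ^ 5"
    have e: "Q * Q ^ 0 = Q" "Q * Q ^ 1 = Q ^ 2" "Q * Q ^ 2 = Q ^ 3" "Q * Q ^ 3 = Q ^ 4" "Q * Q ^ 4 = Q ^ 5"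
      by (simp_all add: eval_nat_numeral)
    have "qpoch Q Q = qpoch Q (Q ^ 5) * qpoch (Q ^ 2) (Q ^ 5) * qpoch (Q ^ 3) (Q ^ 5) * qpoch (Q ^ 4) (Q ^ 5) * qpoch (Q ^ 5) (Q ^ 5)"
      using qpoch_dissect[OF nQ, of 5 Q] unfolding prod_lessThan_5 e by simp
    moreover have "qpoch Q Q ^ 6 = qpoch Q Q * qpoch Q Q ^ 5" by (simp flip: power_Suc)
    ultimately show ?thesis unfolding * by (simp add: mult_ac)
  qed
  have "(\<Prod>j<5. qpoch (w ^ j * p) (w ^ j * p)) = a ^ 5 - 11 * b ^ 5 - c ^ 5"
  proof -
    have "a * c = b\<^sup>2" using r by (simp add: a_def b_def c_def power_mult_distrib power2_eq_square)
    from fifth_root_norm[OF _ this, of w] w[of 1] show ?thesis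
      unfolding diss prod_lessThan_5 by simp
  qed
  also have "b ^ 5 = of_real (q * f ^ 5)" by (simp add: b_def power_mult_distrib p Q_def)
  also have "c ^ 5 = of_real (q\<^sup>2 * (f * r) ^ 5)"
  proof -
    have "(p\<^sup>2) ^ 5 = Q\<^sup>2" by (simp add: p[symmetric] flip: power_mult)
    then show ?thesis by (simp add: c_def power_mult_distrib Q_def)
  qed
  finally have "(a ^ 5 - 11 * of_real (q * f ^ 5) - of_real (q\<^sup>2 * (f * r) ^ 5)) * qpoch (Q ^ 5) (Q ^ 5) = qpoch Q Q ^ 6"
    using P by simp
  moreover have "qpoch (Q ^ 5) (Q ^ 5) = of_real f" "qpoch Q Q = of_real (qpoch q q)"
    using qpoch_of_real[of "q ^ 5" "q ^ 5"] qpoch_of_real[of q q] q q5 by (simp_all add: Q_def f_def)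
  ultimately have "complex_of_real (((f / r) ^ 5 - 11 * (q * f ^ 5) - q\<^sup>2 * (f * r) ^ 5) * f) = of_real (qpoch q q ^ 6)"
    by (simp add: a_def)
  then have "((f / r) ^ 5 - 11 * (q * f ^ 5) - q\<^sup>2 * (f * r) ^ 5) * f = qpoch q q ^ 6"
    by (simp only: of_real_eq_iff)
  moreover have "((f / r) ^ 5 - 11 * (q * f ^ 5) - q\<^sup>2 * (f * r) ^ 5) * f = f ^ 6 * ((1 / r) ^ 5 - 11 * q - q\<^sup>2 * r ^ 5)"
    by (simp add: power_divide power_mult_distrib algebra_simps eval_nat_numeral)
  ultimately show ?thesis by (simp add: f_def)
qed

subsection \<open>The Rogers--Ramanujan continued fraction\<close>

text \<open>Pairing \<open>- r\<close> with \<open>r + 1\<close> is what turns the bilateral theta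
  series into Rogers' series, whose terms contain a difference of two powers.\<close>

lemma infsum_int_split:
  fixes f :: "int \<Rightarrow> real"
  assumes "f summable_on UNIV"
  shows "(\<Sum>\<^sub>\<infinity>n. f n) = (\<Sum>r. f (- int r) + f (int r + 1))"
proof -
  let ?A = "range (\<lambda>r. - int r)" and ?B = "range (\<lambda>r. int r + 1)"
  have "x \<in> ?A \<union> ?B" for x
  proof (cases "x \<le> 0")
    case True
    then have "x = - int (nat (- x))" by simp
    then show ?thesis by blast
  next
    case False
    then have "x = int (nat (x - 1)) + 1" by simp
    then show ?thesis by blast
  qed
  then have U: "UNIV = ?A \<union> ?B" by blast
  have D: "?A \<inter> ?B = {}" by auto
  have sA: "f summable_on ?A" and sB: "f summable_on ?B"
    using summable_on_subset_banach[OF assms] by auto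
  have rA: "infsum f ?A = (\<Sum>\<^sub>\<infinity>r. f (- int r))" "(\<lambda>r. f (- int r)) summable_on UNIV"
    using infsum_reindex[of "\<lambda>r. - int r" UNIV f] summable_on_reindex[of "\<lambda>r. - int r" UNIV f] sA
    by (simp_all add: inj_on_def o_def)
  have rB: "infsum f ?B = (\<Sum>\<^sub>\<infinity>r. f (int r + 1))" "(\<lambda>r. f (int r + 1)) summable_on UNIV"
    using infsum_reindex[of "\<lambda>r. int r + 1" UNIV f] summable_on_reindex[of "\<lambda>r. int r + 1" UNIV f] sB
    by (simp_all add: inj_on_def o_def)
  have "(\<Sum>\<^sub>\<infinity>n. f n) = infsum f ?A + infsum f ?B"
    by (subst U) (rule infsum_Un_disjoint[OF sA sB D])
  also have "\<dots> = (\<Sum>\<^sub>\<infinity>r. f (- int r) + f (int r + 1))"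
    unfolding rA(1) rB(1) by (rule infsum_add[OF rA(2) rB(2), symmetric])
  also have "\<dots> = (\<Sum>r. f (- int r) + f (int r + 1))"
    using has_sum_imp_sums[OF has_sum_infsum[OF summable_on_add[OF rA(2) rB(2)]]] by (simp add: sums_iff)
  finally show ?thesis .
qed

text \<open>A crude bound by completing the square in \<open>a\<close>. The coefficient
  \<open>2 * d + 7\<close> is the worst case over both signs of \<open>n\<close>:
  \<open>2 * d\<close> from the linear term, 5 from \<open>tri\<close>, 2 from the doubled absolute
  value.\<close>

lemma theta_exponent_ge:
  assumes "0 \<le> d"
  shows "\<bar>n\<bar> - (d + 4)\<^sup>2 \<le> d * n + 5 * tri n"
proof -
  define a where "a = \<bar>n\<bar>"
  have "0 \<le> (a - (d + 4))\<^sup>2 + 4 * a\<^sup>2 + a + (d + 4)\<^sup>2" by (simp add: a_def)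
  also have "\<dots> = 5 * a\<^sup>2 - (2 * d + 7) * a + 2 * (d + 4)\<^sup>2"
    by (simp add: power2_eq_square algebra_simps)
  finally have "0 \<le> 5 * a\<^sup>2 - (2 * d + 7) * a + 2 * (d + 4)\<^sup>2" .
  moreover have "- (2 * d * a) \<le> 2 * d * n" "- (5 * a) \<le> - (5 * n)"
    using assms mult_left_mono[of "- a" n "2 * d"] by (auto simp: a_def)
  moreover have "2 * (d * n + 5 * tri n) = 2 * d * n + 5 * a\<^sup>2 - 5 * n"
    using two_times_tri[of n] by (simp add: a_def power2_eq_square algebra_simps)
  ultimately show ?thesis
    unfolding a_def[symmetric] by (simp add: algebra_simps)
qed

text \<open>The functions \<open>H\<^sub>i\<close> of Rogers' proof of the Rogers--Ramanujan identities
  (Hardy and Wright, section 19.14), at \<open>a = q\<^sup>m\<close> and multiplied by \<open>(q; q)\<^sub>\<infinity>\<close>,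
  which turns the infinite product in them into a finite one.\<close>

definition rogers_term :: "real \<Rightarrow> int \<Rightarrow> nat \<Rightarrow> nat \<Rightarrow> real" where
  "rogers_term q i m r = (-1) ^ r * q powi ((2 * int m + 3 - i) * int r + 5 * tri (int r))
     * (1 - q powi (i * (int m + 2 * int r))) * (qfact q (r + m - 1) / qfact q r)"

definition rogers :: "real \<Rightarrow> int \<Rightarrow> nat \<Rightarrow> real" where
  "rogers q i m = (\<Sum>r. rogers_term q i m r)"

section \<open>Rogers' functions: convergence, recurrence, limit and positivity\<close>

context
  fixes q :: real
  assumes q: "0 < q" "q < 1"
begin

lemma qfact_pos: "qfact q n > 0"
  unfolding qfact_def using q by (intro prod_pos) (auto simp: power_less_one_iff simp del: power_Suc)

lemma qfact_le_1: "qfact q n \<le> 1"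
  unfolding qfact_def using q by (intro prod_le_1) (auto simp: power_le_one simp del: power_Suc)

lemma qfact_ratio_bounded: "\<exists>K. \<forall>m n. \<bar>qfact q m / qfact q n\<bar> \<le> K"
proof -
  have "(\<lambda>n. inverse (qfact q n)) \<longlonglongrightarrow> inverse (qpoch q q)"
    by (intro tendsto_inverse qfact_LIMSEQ qpoch_self_nonzero) (use q in auto)
  then obtain K where K: "K > 0" "\<And>n. norm (inverse (qfact q n)) \<le> K"
    using convergent_imp_Bseq[of "\<lambda>n. inverse (qfact q n)"] unfolding convergent_def Bseq_def by blast
  have "\<bar>qfact q m / qfact q n\<bar> \<le> K" for m n
  proof -
    have "\<bar>qfact q m / qfact q n\<bar> = qfact q m * norm (inverse (qfact q n))"
      using qfact_pos[of m] by (simp add: abs_mult divide_inverse)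
    also have "\<dots> \<le> 1 * K"
      using K qfact_le_1[of m] qfact_pos[of m] by (intro mult_mono) auto
    finally show ?thesis by simp
  qed
  then show ?thesis by blast
qed

text \<open>The majorant does not depend on the indices of \<open>qfact\<close>. Hence it yields
  both summability in \<open>r\<close> and the domination needed for the limit in
  \<open>m\<close>.\<close>

lemma rogers_bound:
  assumes K: "\<And>m n. \<bar>qfact q m / qfact q n\<bar> \<le> K" and e: "e \<ge> int r" and c: "\<bar>c\<bar> \<le> 1"
  shows "\<bar>(-1) ^ r * q powi e * c * (qfact q m / qfact q n)\<bar> \<le> K * q ^ r"
proof -
  have "q powi e \<le> q powi int r"
    using q e by (intro power_int_decreasing) auto
  then have "q powi e * \<bar>c\<bar> * \<bar>qfact q m / qfact q n\<bar> \<le> q ^ r * 1 * K"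
    using q c K[of m n] by (intro mult_mono) auto
  also have "\<dots> = K * q ^ r" by simp
  finally have "q powi e * \<bar>c\<bar> * \<bar>qfact q m / qfact q n\<bar> \<le> K * q ^ r" .
  moreover have "\<bar>(-1) ^ r * q powi e * c * (qfact q m / qfact q n)\<bar> = q powi e * \<bar>c\<bar> * \<bar>qfact q m / qfact q n\<bar>"
    unfolding abs_mult using zero_le_power_int[of q e] q by (simp add: power_abs)
  ultimately show ?thesis by (simp only:)
qed

lemma summable_geometric_bound:
  assumes "\<And>r. \<bar>f r\<bar> \<le> K * q ^ r"
  shows "summable (f :: nat \<Rightarrow> real)"
  by (rule summable_comparison_test[of _ "\<lambda>r. K * q ^ r"])
    (use assms q in \<open>auto intro!: summable_mult summable_geometric\<close>)

lemma tri_nat_nonneg: "tri (int r) \<ge> 0"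
  by (cases r) (auto simp: tri_def)

lemma rogers_exponent:
  assumes "i \<le> 2"
  shows "int r \<le> (2 * int m + 3 - i) * int r + 5 * tri (int r)"
proof -
  have "1 * int r \<le> (2 * int m + 3 - i) * int r"
    using assms by (intro mult_right_mono) auto
  then show ?thesis using tri_nat_nonneg[of r] by simp
qed

lemma one_minus_powi_bound: "e \<ge> 0 \<Longrightarrow> \<bar>1 - q powi e\<bar> \<le> 1"
proof -
  assume "e \<ge> 0"
  then have "q powi e \<le> 1" using q by (intro power_int_le_one) auto
  moreover have "0 \<le> q powi e" using q by simp
  ultimately show ?thesis by linarith
qed

lemma rogers_term_bound:
  assumes K: "\<And>m n. \<bar>qfact q m / qfact q n\<bar> \<le> K" and i: "0 \<le> i" "i \<le> 2"
  shows "\<bar>rogers_term q i m r\<bar> \<le> K * q ^ r"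
  unfolding rogers_term_def
  by (rule rogers_bound[OF K rogers_exponent one_minus_powi_bound]) (use i in auto)

lemma summable_rogers_term:
  assumes "0 \<le> i" "i \<le> 2"
  shows "summable (rogers_term q i m)"
proof -
  obtain K where K: "\<And>m n. \<bar>qfact q m / qfact q n\<bar> \<le> K"
    using qfact_ratio_bounded by metis
  from rogers_term_bound[OF K assms] show ?thesis
    by (rule summable_geometric_bound)
qed

lemma rogers_0: "rogers q 0 m = 0"
  by (simp add: rogers_def rogers_term_def)

text \<open>The difference is split as \<open>u + v\<close> so that each bracket cancels a factor of
  the \<open>qfact\<close> quotient: \<open>1 - q ^ (r + m)\<close> extends the numerator in
  \<open>u\<close>, and \<open>1 - q ^ r\<close> shortens the denominator in \<open>v\<close>. Since
  \<open>v 0 = 0\<close>, the series \<open>v\<close> may be shifted by one before it is added to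
  \<open>u\<close>.\<close>

lemma rogers_step:
  assumes i: "1 \<le> i" "i \<le> 2" and m: "m \<ge> 1"
  shows "rogers q i m - rogers q (i - 1) m = q powi ((i - 1) * int m) * rogers q (3 - i) (Suc m)"
proof -
  obtain K where K: "\<And>m n. \<bar>qfact q m / qfact q n\<bar> \<le> K"
    using qfact_ratio_bounded by metis
  define e where "e r = (2 * int m + 3) * int r + 5 * tri (int r)" for r
  define u where "u r = (-1) ^ r * q powi (e r + (i - 1) * (int m + int r)) * 1 * (qfact q (r + m) / qfact q r)" for r
  define v where "v r = (-1) ^ r * q powi (e r - i * int r) * (1 - q ^ r) * (qfact q (r + m - 1) / qfact q r)" for r
  have pw: "q powi (a + b) = q powi a * q powi b" for a b
    using q by (simp add: power_int_add)
  have uv: "rogers_term q i m r - rogers_term q (i - 1) m r = u r + v r" for r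
  proof -
    have "qfact q (r + m) = qfact q (r + m - 1) * (1 - q powi (int r + int m))"
    proof -
      have "qfact q (Suc (r + m - 1)) = qfact q (r + m - 1) * (1 - q ^ Suc (r + m - 1))"
        by (rule qfact_Suc)
      then show ?thesis using m by (simp add: power_int_def nat_add_distrib)
    qed
    then have U: "u r = (-1) ^ r * (q powi (e r + (i - 1) * (int m + int r)) - q powi (e r + i * (int m + int r))) * (qfact q (r + m - 1) / qfact q r)"
    proof -
      assume *: "qfact q (r + m) = qfact q (r + m - 1) * (1 - q powi (int r + int m))"
      have "e r + i * (int m + int r) = (e r + (i - 1) * (int m + int r)) + (int r + int m)"
        by (simp add: algebra_simps)
      then have P: "q powi (e r + i * (int m + int r)) = q powi (e r + (i - 1) * (int m + int r)) * q powi (int r + int m)"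
        by (simp only: pw)
      have "s * x * 1 * (a * (1 - z) / b) = s * (x - x * z) * (a / b)" for s x a z b :: real
        by (simp add: algebra_simps diff_divide_distrib)
      then show ?thesis unfolding u_def * P .
    qed
    have "e r - (i - 1) * int r = (e r - i * int r) + int r" by (simp add: algebra_simps)
    then have "q powi (e r - (i - 1) * int r) = q powi (e r - i * int r) * q ^ r"
      by (simp only: pw power_int_of_nat)
    then have V: "v r = (-1) ^ r * (q powi (e r - i * int r) - q powi (e r - (i - 1) * int r)) * (qfact q (r + m - 1) / qfact q r)"
      by (simp add: v_def algebra_simps)
    have R: "rogers_term q i' m r = (-1) ^ r * (q powi (e r - i' * int r) - q powi (e r + i' * (int m + int r))) * (qfact q (r + m - 1) / qfact q r)" for i'
    proof -
      have "(2 * int m + 3 - i') * int r + 5 * tri (int r) = e r - i' * int r"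
        "e r + i' * (int m + int r) = (e r - i' * int r) + i' * (int m + 2 * int r)"
        by (simp_all add: e_def algebra_simps)
      then show ?thesis unfolding rogers_term_def by (simp only: pw) (simp add: algebra_simps)
    qed
    show ?thesis unfolding R U V by (simp add: algebra_simps)
  qed
  have su: "summable u"
  proof (rule summable_geometric_bound)
    show "\<bar>u r\<bar> \<le> K * q ^ r" for r
      unfolding u_def
    proof (rule rogers_bound[OF K])
      have "0 \<le> (i - 1) * (int m + int r)" using i by simp
      then show "int r \<le> e r + (i - 1) * (int m + int r)"
        using rogers_exponent[of 0 r m] by (simp add: e_def)
    qed simp
  qed
  have sv: "summable v"
  proof (rule summable_geometric_bound)
    show "\<bar>v r\<bar> \<le> K * q ^ r" for r
      unfolding v_def
    proof (rule rogers_bound[OF K])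
      show "int r \<le> e r - i * int r"
        using rogers_exponent[OF i(2), of r m] by (simp add: e_def algebra_simps)
      show "\<bar>1 - q ^ r\<bar> \<le> 1" using one_minus_powi_bound[of "int r"] by simp
    qed
  qed
  \<comment> \<open>After the shift both terms carry the same quotient
    \<open>qfact q (r + m) / qfact q r\<close>, the one belonging to \<open>Suc m\<close>; the sign
    change and the extra power of \<open>q\<close> form the bracket of the new term.\<close>
  have w: "u r + v (Suc r) = q powi ((i - 1) * int m) * rogers_term q (3 - i) (Suc m) r" for r
  proof -
    have E: "tri (int (Suc r)) = tri (int r) + int r"
      using tri_add_1[of "int r"] by (simp add: add.commute)
    have "v (Suc r) = - ((-1) ^ r * q powi (e (Suc r) - i * int (Suc r)) * (qfact q (r + m) / qfact q r))"
      using qfact_pos[of r] one_minus_power_nonzero[of q "Suc r"] q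
      by (simp add: v_def qfact_Suc del: of_nat_Suc power_Suc) (simp add: field_simps)
    moreover have "e (Suc r) - i * int (Suc r) = (e r + (i - 1) * (int m + int r)) + (3 - i) * (int (Suc m) + 2 * int r)"
      unfolding e_def E by (simp add: algebra_simps)
    ultimately have "u r + v (Suc r) = (-1) ^ r * q powi (e r + (i - 1) * (int m + int r)) * (1 - q powi ((3 - i) * (int (Suc m) + 2 * int r))) * (qfact q (r + m) / qfact q r)"
      by (simp only: u_def pw) (simp add: algebra_simps)
    moreover have "e r + (i - 1) * (int m + int r) = (i - 1) * int m + ((2 * int (Suc m) + 3 - (3 - i)) * int r + 5 * tri (int r))"
      by (simp add: e_def algebra_simps)
    ultimately show ?thesis
      unfolding rogers_term_def by (simp only: pw) (simp add: mult_ac)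
  qed
  have "rogers q i m - rogers q (i - 1) m = (\<Sum>r. u r + v r)"
    unfolding rogers_def uv[symmetric] using i by (intro suminf_diff summable_rogers_term) auto
  also have "\<dots> = suminf u + suminf v" by (rule suminf_add[symmetric, OF su sv])
  also have "suminf v = (\<Sum>r. v (Suc r))"
    using suminf_split_head[OF sv] by (simp add: v_def)
  also have "suminf u + (\<Sum>r. v (Suc r)) = (\<Sum>r. u r + v (Suc r))"
    by (rule suminf_add[OF su]) (use sv in \<open>simp add: summable_Suc_iff\<close>)
  also have "\<dots> = q powi ((i - 1) * int m) * rogers q (3 - i) (Suc m)"
    unfolding w rogers_def by (rule suminf_mult) (use i in \<open>auto intro!: summable_rogers_term\<close>)
  finally show ?thesis .
qed

lemma rogers_1: "m \<ge> 1 \<Longrightarrow> rogers q 1 m = rogers q 2 (Suc m)"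
  using rogers_step[of 1 m] by (simp add: rogers_0)

text \<open>Divided by \<open>rogers q 2 (Suc m)\<close>, this is one level of the continued
  fraction.\<close>

lemma rogers_recurrence:
  "m \<ge> 1 \<Longrightarrow> rogers q 2 m = rogers q 2 (Suc m) + q ^ m * rogers q 2 (Suc (Suc m))"
  using rogers_step[of 2 m] by (simp add: rogers_1)

lemma rogers_LIMSEQ: "rogers q 2 \<longlonglongrightarrow> qpoch q q"
proof -
  obtain K where K: "\<And>m n. \<bar>qfact q m / qfact q n\<bar> \<le> K"
    using qfact_ratio_bounded by metis
  define b where "b r = (if r = 0 then qpoch q q else 0)" for r :: nat
  have "(\<lambda>m. \<Sum>r. rogers_term q 2 m r) \<longlonglongrightarrow> suminf b"
  proof (rule tannerys_theorem[THEN conjunct2, THEN conjunct2])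
    show "summable (\<lambda>r. K * q ^ r)" using q by (intro summable_mult summable_geometric) auto
    show "\<forall>\<^sub>F (r, m) in sequentially \<times>\<^sub>F sequentially. norm (rogers_term q 2 m r) \<le> K * q ^ r"
      using rogers_term_bound[OF K, of 2] by (auto intro!: always_eventually)
    fix r
    show "(\<lambda>m. rogers_term q 2 m r) \<longlonglongrightarrow> b r"
    proof (cases "r = 0")
      case True
      have "(\<lambda>m. (1 - (q ^ m)\<^sup>2) * qfact q (m - 1)) \<longlonglongrightarrow> (1 - 0\<^sup>2) * qpoch q q"
        by (intro tendsto_intros filterlim_compose[OF qfact_LIMSEQ] filterlim_minus_const_nat_at_top) (use q in auto)
      moreover have "rogers_term q 2 m 0 = (1 - (q ^ m)\<^sup>2) * qfact q (m - 1)" for m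
      proof -
        have "q powi (2 * int m) = (q ^ m)\<^sup>2"
          by (simp add: power_int_def nat_mult_distrib mult.commute flip: power_mult)
        then show ?thesis by (simp add: rogers_term_def tri_def)
      qed
      ultimately show ?thesis using True by (simp add: b_def)
    next
      case False
      have B: "norm (rogers_term q 2 m r) \<le> K * q ^ m" for m
      proof -
        have e: "(2 * int m + 3 - 2) * int r + 5 * tri (int r) \<ge> int m"
        proof -
          have "int m * 1 \<le> (2 * int m + 3 - 2) * int r"
            using False by (intro mult_mono) auto
          then have "int m \<le> (2 * int m + 3 - 2) * int r" by (simp only: mult_1_right)
          moreover have "0 \<le> 5 * tri (int r)" using tri_nat_nonneg[of r] by simp
          ultimately show ?thesis by (rule add_increasing2[rotated])
        qed
        \<comment> \<open>For \<open>r \<ge> 1\<close> the exponent is at least \<open>m\<close>, so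
          \<open>rogers_bound\<close> applies with \<open>m\<close> in the place of \<open>r\<close>
          and shows decay in \<open>m\<close>. The sign \<open>(-1) ^ m\<close> only fits its
          pattern and disappears in the absolute value.\<close>
        have "\<bar>(-1) ^ m * q powi ((2 * int m + 3 - 2) * int r + 5 * tri (int r))
            * (1 - q powi (2 * (int m + 2 * int r))) * (qfact q (r + m - 1) / qfact q r)\<bar> \<le> K * q ^ m"
          by (rule rogers_bound[OF K e one_minus_powi_bound]) simp
        then show ?thesis by (simp only: real_norm_def rogers_term_def abs_mult power_abs abs_minus_cancel abs_one power_one)
      qed
      have "(\<lambda>m. K * q ^ m) \<longlonglongrightarrow> 0"
        using q tendsto_mult_right_zero[OF LIMSEQ_power_zero[of q], of K] by simp
      then have "(\<lambda>m. rogers_term q 2 m r) \<longlonglongrightarrow> 0"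
        by (rule Lim_null_comparison[OF always_eventually[OF allI[OF B]]])
      then show ?thesis using False by (simp add: b_def)
    qed
  qed auto
  moreover have "suminf b = qpoch q q"
    using suminf_finite[of "{0}" b] by (simp add: b_def)
  ultimately show ?thesis unfolding rogers_def by simp
qed

text \<open>Positivity holds far out because the limit is positive, and the recurrence, having
  positive coefficients, carries it down. The base case covers all \<open>n \<ge> N\<close>, where
  the truncated \<open>N - n\<close> is 0.\<close>

lemma rogers_pos:
  assumes "m \<ge> 1"
  shows "rogers q 2 m > 0"
proof -
  have "qpoch q q > 0" using q by (intro qpoch_pos) auto
  then have "\<forall>\<^sub>F n in sequentially. rogers q 2 n > 0"
    by (rule order_tendstoD(1)[OF rogers_LIMSEQ])
  then obtain N where N: "rogers q 2 n > 0" if "n \<ge> N" for n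
    unfolding eventually_sequentially by blast
  have "rogers q 2 (Suc n) > 0 \<and> rogers q 2 (Suc (Suc n)) > 0" for n
  proof (induction "N - n" arbitrary: n)
    case 0
    then show ?case by (intro conjI N) auto
  next
    case (Suc d)
    then have IH: "rogers q 2 (Suc (Suc n)) > 0" "rogers q 2 (Suc (Suc (Suc n))) > 0"
      using Suc.hyps(1)[of "Suc n"] by auto
    have "rogers q 2 (Suc n) = rogers q 2 (Suc (Suc n)) + q ^ Suc n * rogers q 2 (Suc (Suc (Suc n)))"
      by (rule rogers_recurrence) simp
    moreover have "0 < q ^ Suc n * rogers q 2 (Suc (Suc (Suc n)))"
      using IH(2) q by (intro mult_pos_pos zero_less_power) auto
    ultimately show ?case using IH(1) by linarith
  qed
  from this[of "m - 1"] show ?thesis using assms by simp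
qed

section \<open>Convergence and value of the continued fraction\<close>

lemma rr_denom_ge_1: "rr_denom q m n \<ge> 1"
proof (induction n arbitrary: m)
  case (Suc n)
  have "0 < rr_denom q (Suc m) n" using Suc[of "Suc m"] by simp
  then show ?case using q by simp
qed simp

text \<open>The ratio \<open>\<rho> m\<close> satisfies the continued fraction relation exactly,
  whereas the convergent replaces the tail \<open>\<rho> (m + n)\<close> by 1. Each level contracts
  the error by at least the factor \<open>q\<close>, as both denominators are at least 1 and
  \<open>m \<ge> 1\<close>.\<close>

lemma rr_denom_LIMSEQ: "rr_denom q 1 \<longlonglongrightarrow> rogers q 2 1 / rogers q 2 2"
proof -
  define \<rho> where "\<rho> m = rogers q 2 m / rogers q 2 (Suc m)" for m
  have rho: "\<rho> m = 1 + q ^ m / \<rho> (Suc m)" "\<rho> m \<ge> 1" if "m \<ge> 1" for m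
  proof -
    have pos: "rogers q 2 (Suc m) > 0" "rogers q 2 (Suc (Suc m)) > 0" by (simp_all add: rogers_pos)
    then show "\<rho> m = 1 + q ^ m / \<rho> (Suc m)"
      unfolding \<rho>_def rogers_recurrence[OF that] by (simp add: add_divide_distrib)
    moreover have "q ^ m / \<rho> (Suc m) > 0" unfolding \<rho>_def using pos q by simp
    ultimately show "\<rho> m \<ge> 1" by simp
  qed
  have bound: "\<bar>rr_denom q m n - \<rho> m\<bar> \<le> q ^ n * \<bar>1 - \<rho> (m + n)\<bar>" if "m \<ge> 1" for m n
    using that
  proof (induction n arbitrary: m)
    case (Suc n)
    define x where "x = rr_denom q (Suc m) n"
    define y where "y = \<rho> (Suc m)"
    have xy: "x \<ge> 1" "y \<ge> 1" using rr_denom_ge_1 rho(2)[of "Suc m"] by (auto simp: x_def y_def)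
    have "rr_denom q m (Suc n) - \<rho> m = q ^ m / x - q ^ m / y"
      using rho(1)[OF Suc.prems] by (simp add: x_def y_def)
    also have "\<dots> = q ^ m * ((y - x) / (x * y))"
      using xy by (simp add: field_simps)
    finally have "\<bar>rr_denom q m (Suc n) - \<rho> m\<bar> = q ^ m * (\<bar>y - x\<bar> / (x * y))"
      using xy q by (simp add: abs_mult)
    also have "\<dots> \<le> q ^ 1 * (\<bar>y - x\<bar> / 1)"
    proof (intro mult_mono)
      have "1 * 1 \<le> x * y" using xy by (intro mult_mono) auto
      then show "\<bar>y - x\<bar> / (x * y) \<le> \<bar>y - x\<bar> / 1" by (intro divide_left_mono) auto
      show "q ^ m \<le> q ^ 1" using q Suc.prems by (intro power_decreasing) auto
    qed (use q xy in auto)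
    also have "\<dots> \<le> q * (q ^ n * \<bar>1 - \<rho> (Suc m + n)\<bar>)"
      using Suc.IH[of "Suc m"] q by (simp add: x_def y_def abs_minus_commute)
    finally show ?case by simp
  qed simp
  have "\<rho> \<longlonglongrightarrow> qpoch q q / qpoch q q"
    unfolding \<rho>_def using q by (intro tendsto_divide rogers_LIMSEQ LIMSEQ_Suc qpoch_self_nonzero) auto
  then have "(\<lambda>n. \<rho> (1 + n)) \<longlonglongrightarrow> 1"
    using qpoch_self_nonzero[of q] q LIMSEQ_Suc[of \<rho>] by simp
  then have "(\<lambda>n. q ^ n * \<bar>1 - \<rho> (1 + n)\<bar>) \<longlonglongrightarrow> 0 * \<bar>1 - 1\<bar>"
    using q by (intro tendsto_intros) auto
  then have L: "(\<lambda>n. q ^ n * \<bar>1 - \<rho> (1 + n)\<bar>) \<longlonglongrightarrow> 0" by simp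
  have B: "norm (rr_denom q 1 n - \<rho> 1) \<le> q ^ n * \<bar>1 - \<rho> (1 + n)\<bar>" for n
    using bound[of 1 n] by simp
  have "(\<lambda>n. rr_denom q 1 n - \<rho> 1) \<longlonglongrightarrow> 0"
    by (rule Lim_null_comparison[OF always_eventually[OF allI[OF B]] L])
  then show ?thesis by (simp add: \<rho>_def LIM_zero_iff numeral_2_eq_2)
qed

text \<open>At \<open>m = 1\<close> the quotient of the two \<open>qfact\<close> values is 1, and
  the paired theta series is Rogers' series term by term.\<close>

lemma rr_den_eq_rogers: "rr_den q = rogers q 2 1"
proof -
  define f where "f n = (-1) powi n * q powi (2 * n + 5 * tri n)" for n
  have "abs_summable f"
    unfolding f_def by (rule weighted_theta_abs_summable[OF q theta_exponent_ge, of _ _ 1 0]) (auto simp: power_int_abs)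
  from infsum_int_split[OF abs_summable_summable[OF this]]
  have "rr_den q = (\<Sum>r. f (- int r) + f (int r + 1))" by (simp add: rr_den_def f_def)
  also have "(\<lambda>r. f (- int r) + f (int r + 1)) = rogers_term q 2 1"
  proof
    fix r
    have "2 * (- int r) + 5 * tri (- int r) = 3 * int r + 5 * tri (int r)"
      unfolding tri_minus by simp
    moreover have "2 * (int r + 1) + 5 * tri (int r + 1) = (3 * int r + 5 * tri (int r)) + (2 * (1 + 2 * int r))"
      unfolding tri_add_1 by simp
    moreover have "q powi (a + b) = q powi a * q powi b" for a b
      using q by (simp add: power_int_add)
    moreover have "(-1) powi (- int r) = (-1 :: real) ^ r" "(-1) powi (int r + 1) = - ((-1 :: real) ^ r)"
      by (simp_all add: power_int_minus_one_minus power_int_add)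
    ultimately have "f (- int r) + f (int r + 1) = (-1) ^ r * q powi (3 * int r + 5 * tri (int r)) * (1 - q powi (2 * (1 + 2 * int r)))"
      unfolding f_def by (simp only:) (simp add: algebra_simps)
    then show "f (- int r) + f (int r + 1) = rogers_term q 2 1 r"
      using qfact_pos[of r] by (simp add: rogers_term_def)
  qed
  finally show ?thesis by (simp add: rogers_def)
qed

text \<open>The term-by-term match is with \<open>rogers q 1 1\<close>; \<open>rogers_1\<close> then
  moves it to \<open>rogers q 2 2\<close>.\<close>

lemma rr_num_eq_rogers: "rr_num q = rogers q 2 2"
proof -
  define f where "f n = (-1) powi n * q powi (1 * n + 5 * tri n)" for n
  have "abs_summable f"
    unfolding f_def by (rule weighted_theta_abs_summable[OF q theta_exponent_ge, of _ _ 1 0]) (auto simp: power_int_abs)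
  from infsum_int_split[OF abs_summable_summable[OF this]]
  have "rr_num q = (\<Sum>r. f (- int r) + f (int r + 1))" by (simp add: rr_num_def f_def)
  also have "(\<lambda>r. f (- int r) + f (int r + 1)) = rogers_term q 1 1"
  proof
    fix r
    have "1 * (- int r) + 5 * tri (- int r) = 4 * int r + 5 * tri (int r)"
      unfolding tri_minus by simp
    moreover have "1 * (int r + 1) + 5 * tri (int r + 1) = (4 * int r + 5 * tri (int r)) + (1 * (1 + 2 * int r))"
      unfolding tri_add_1 by simp
    moreover have "q powi (a + b) = q powi a * q powi b" for a b
      using q by (simp add: power_int_add)
    moreover have "(-1) powi (- int r) = (-1 :: real) ^ r" "(-1) powi (int r + 1) = - ((-1 :: real) ^ r)"
      by (simp_all add: power_int_minus_one_minus power_int_add)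
    ultimately have "f (- int r) + f (int r + 1) = (-1) ^ r * q powi (4 * int r + 5 * tri (int r)) * (1 - q powi (1 * (1 + 2 * int r)))"
      unfolding f_def by (simp only:) (simp add: algebra_simps)
    then show "f (- int r) + f (int r + 1) = rogers_term q 1 1 r"
      using qfact_pos[of r] by (simp add: rogers_term_def)
  qed
  finally show ?thesis using rogers_1[of 1] by (simp add: rogers_def numeral_2_eq_2)
qed

theorem rr_cfrac_eq: "rr_cfrac q = root 5 q * rr_num q / rr_den q"
proof -
  have "(\<lambda>n. root 5 q / rr_denom q 1 n) \<longlonglongrightarrow> root 5 q / (rr_den q / rr_num q)"
    unfolding rr_den_eq_rogers rr_num_eq_rogers using rogers_pos[of 1] rogers_pos[of 2]
    by (intro tendsto_intros rr_denom_LIMSEQ) auto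
  then show ?thesis unfolding rr_cfrac_def by (simp add: limI)
qed

end

subsection \<open>The Wronskian of the two theta series\<close>

lemma infsum_diff:
  fixes f g :: "'b \<Rightarrow> 'a :: real_normed_vector"
  assumes "f summable_on A" "g summable_on A"
  shows "(\<Sum>\<^sub>\<infinity>x\<in>A. f x - g x) = infsum f A - infsum g A"
  using infsum_add[OF assms(1) summable_on_uminus[THEN iffD2, OF assms(2)]] by (simp add: infsum_uminus)

text \<open>The weight completes the square: \<open>40 * (d * n + 5 * tri n) = (10 * n + 2 * d -
  5)^2 - (2 * d - 5)^2\<close>. So passing from \<open>k = 0\<close> to \<open>k = 2\<close> is, up
  to the factor 40, the operator \<open>q d/dq\<close> on the series multiplied by \<open>q\<close>
  to the power \<open>(2 * d - 5)^2 / 40\<close>.\<close>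

definition wtheta :: "nat \<Rightarrow> int \<Rightarrow> real \<Rightarrow> real" where
  "wtheta k d q = (\<Sum>\<^sub>\<infinity>n. (-1) powi n * real_of_int (10 * n + 2 * d - 5) ^ k * q powi (d * n + 5 * tri n))"

lemma rr_num_wtheta: "rr_num q = wtheta 0 1 q"
  and rr_den_wtheta: "rr_den q = wtheta 0 2 q"
  by (simp_all add: rr_num_def rr_den_def wtheta_def)

lemma linear_weight_bound:
  fixes n :: int
  shows "\<bar>(-1) powi n * real_of_int (a * n + c) ^ k\<bar> \<le> real_of_int (\<bar>a\<bar> + \<bar>c\<bar>) ^ k * real_of_int (1 + \<bar>n\<bar>) ^ k"
proof -
  have "\<bar>a * n + c\<bar> \<le> \<bar>a\<bar> * \<bar>n\<bar> + \<bar>c\<bar> * 1" by (simp add: abs_mult[symmetric] abs_triangle_ineq)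
  also have "\<dots> \<le> (\<bar>a\<bar> + \<bar>c\<bar>) * (1 + \<bar>n\<bar>)" by (simp add: algebra_simps)
  finally have "real_of_int \<bar>a * n + c\<bar> \<le> real_of_int ((\<bar>a\<bar> + \<bar>c\<bar>) * (1 + \<bar>n\<bar>))" by (rule of_int_le_iff[THEN iffD2])
  then have "\<bar>real_of_int (a * n + c)\<bar> \<le> real_of_int (\<bar>a\<bar> + \<bar>c\<bar>) * real_of_int (1 + \<bar>n\<bar>)" by (simp only: of_int_abs of_int_mult)
  then have "\<bar>real_of_int (a * n + c)\<bar> ^ k \<le> (real_of_int (\<bar>a\<bar> + \<bar>c\<bar>) * real_of_int (1 + \<bar>n\<bar>)) ^ k"
    by (rule power_mono) simp
  then show ?thesis
    by (simp only: abs_mult power_abs power_mult_distrib power_int_abs abs_minus_cancel abs_one power_int_1_left mult_1_left)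
qed

lemma wtheta_summable:
  assumes "0 < q" "q < 1" "0 \<le> d"
  shows "abs_summable (\<lambda>n. (-1) powi n * real_of_int (10 * n + 2 * d - 5) ^ k * q powi (d * n + 5 * tri n))"
  using linear_weight_bound[of _ 10 "2 * d - 5" k]
  by (intro weighted_theta_abs_summable[OF assms(1,2) theta_exponent_ge[OF assms(3)]]) (simp only: add_diff_eq)

lemma wtheta_reflect:
  assumes "even k"
  shows "wtheta k d q = wtheta k (5 - d) q"
proof -
  have "wtheta k d q = (\<Sum>\<^sub>\<infinity>n. (-1) powi (0 - n) * real_of_int (10 * (0 - n) + 2 * d - 5) ^ k * q powi (d * (0 - n) + 5 * tri (0 - n)))"
    unfolding wtheta_def by (rule infsum_int_reflect[symmetric])
  also have "\<dots> = wtheta k (5 - d) q"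
    unfolding wtheta_def
  proof (rule infsum_cong)
    fix n :: int
    have "real_of_int (10 * (0 - n) + 2 * d - 5) = - real_of_int (10 * n + 2 * (5 - d) - 5)" by simp
    moreover have "d * (0 - n) + 5 * tri (0 - n) = (5 - d) * n + 5 * tri n"
      using tri_minus[of n] by (simp add: algebra_simps)
    moreover have "(-1) powi (0 - n) = (-1 :: real) powi n" by (simp add: power_int_minus_one_minus)
    ultimately show "(-1) powi (0 - n) * real_of_int (10 * (0 - n) + 2 * d - 5) ^ k * q powi (d * (0 - n) + 5 * tri (0 - n))
       = (-1) powi n * real_of_int (10 * n + 2 * (5 - d) - 5) ^ k * q powi ((5 - d) * n + 5 * tri n)"
      using assms by (simp only: power_minus_even)
  qed
  finally show ?thesis .
qed

text \<open>For even \<open>k\<close>, this and \<open>wtheta_reflect\<close> reduce every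
  \<open>d\<close> not divisible by 5 to \<open>d = 1\<close> or \<open>d = 2\<close>.\<close>

lemma wtheta_shift:
  assumes "0 < q"
  shows "wtheta k (d + 5) q = - (q powi (- d)) * wtheta k d q"
proof -
  have "wtheta k d q = (\<Sum>\<^sub>\<infinity>n. (-1) powi (n + 1) * real_of_int (10 * (n + 1) + 2 * d - 5) ^ k * q powi (d * (n + 1) + 5 * tri (n + 1)))"
    unfolding wtheta_def by (rule infsum_int_shift[symmetric])
  also have "\<dots> = (\<Sum>\<^sub>\<infinity>n. - (q powi d) * ((-1) powi n * real_of_int (10 * n + 2 * (d + 5) - 5) ^ k * q powi ((d + 5) * n + 5 * tri n)))"
  proof (rule infsum_cong)
    fix n :: int
    have "10 * (n + 1) + 2 * d - 5 = 10 * n + 2 * (d + 5) - 5" by simp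
    moreover have "d * (n + 1) + 5 * tri (n + 1) = d + ((d + 5) * n + 5 * tri n)"
      unfolding tri_add_1 by (simp add: algebra_simps)
    moreover have "q powi (d + ((d + 5) * n + 5 * tri n)) = q powi d * q powi ((d + 5) * n + 5 * tri n)"
      using assms by (simp only: power_int_add less_imp_neq[symmetric] simp_thms)
    moreover have "(-1) powi (n + 1) = - ((-1 :: real) powi n)" by (simp add: power_int_add)
    ultimately show "(-1) powi (n + 1) * real_of_int (10 * (n + 1) + 2 * d - 5) ^ k * q powi (d * (n + 1) + 5 * tri (n + 1))
       = - (q powi d) * ((-1) powi n * real_of_int (10 * n + 2 * (d + 5) - 5) ^ k * q powi ((d + 5) * n + 5 * tri n))"
      by (simp only: mult_minus_left mult_minus_right mult_ac)
  qed
  also have "\<dots> = - (q powi d) * wtheta k (d + 5) q"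
    unfolding wtheta_def by (rule infsum_cmult_right')
  finally show ?thesis using assms by (simp add: power_int_minus field_simps)
qed

text \<open>The substitution \<open>i = h + 2 g + r\<close>, \<open>j = 2 h - g\<close> comes from multiplication by \<open>2 + \<i>\<close>, of norm 5:
  with \<open>s = 2 i + 1\<close>, \<open>t = 2 j + 1\<close>, \<open>M = 2 s - t = 10 g + 4 r + 1\<close>, \<open>N = s + 2 t = 10 h + 2 r + 3\<close> one has
  \<open>M\<^sup>2 + N\<^sup>2 = 5 (s\<^sup>2 + t\<^sup>2)\<close> and \<open>M\<^sup>2 - N\<^sup>2 = 3 s\<^sup>2 - 8 s t - 3 t\<^sup>2\<close>. The five values of \<open>r\<close> label the cosets
  of the ideal \<open>(2 + \<i>)\<close> in the Gaussian integers.\<close>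

theorem theta_wronskian:
  fixes q :: real
  assumes q: "0 < q" "q < 1"
  shows "wtheta 0 2 q * wtheta 2 1 q - wtheta 0 1 q * wtheta 2 2 q = 8 * qpoch q q ^ 6"
proof -
  define F where "F k i = (-1) powi i * real_of_int (2 * i + 1) ^ k * q powi (tri i + i)" for k :: nat and i :: int
  \<comment> \<open>The coefficients are those of \<open>3 s^2 - 8 s t - 3 t^2\<close>. The outer
    two contributions cancel after summation, and the middle one is -8 times the square of Jacobi's
    bilateral series \<open>2 * qpoch q q ^ 3\<close>, whence -32.\<close>
  define G where "G = (\<lambda>(i, j). 3 * (F 2 i * F 0 j) + - 8 * (F 1 i * F 1 j) + - 3 * (F 0 i * F 2 j))"
  have F: "abs_summable (F k)" for k
  proof -
    have "\<bar>n\<bar> - 2 \<le> tri n + n" for n :: int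
      using tri_ge[of "n + 1"] by (simp add: tri_add_1)
    from weighted_theta_abs_summable[OF q this linear_weight_bound[of _ 2 1 k]]
    show ?thesis by (simp only: F_def)
  qed
  have S: "(\<lambda>(i, j). F k i * F l j) summable_on UNIV" for k l
    by (rule abs_summable_summable[OF abs_summable_times[OF F F]])
  have P: "(\<Sum>\<^sub>\<infinity>(i, j). F k i * F l j) = infsum (F k) UNIV * infsum (F l) UNIV" for k l
    by (rule infsum_times[OF F F, symmetric])
  have GS: "((\<lambda>(i, j). 3 * (F 2 i * F 0 j)) has_sum 3 * (infsum (F 2) UNIV * infsum (F 0) UNIV)) UNIV"
      "((\<lambda>(i, j). - 8 * (F 1 i * F 1 j)) has_sum - 8 * (infsum (F 1) UNIV * infsum (F 1) UNIV)) UNIV"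
      "((\<lambda>(i, j). - 3 * (F 0 i * F 2 j)) has_sum - 3 * (infsum (F 0) UNIV * infsum (F 2) UNIV)) UNIV"
    using has_sum_cmult_right[OF has_sum_infsum[OF S], of 3 2 0] has_sum_cmult_right[OF has_sum_infsum[OF S], of "- 8" 1 1]
      has_sum_cmult_right[OF has_sum_infsum[OF S], of "- 3" 0 2]
    unfolding P by (simp_all only: case_prod_unfold)
  have "(G has_sum 3 * (infsum (F 2) UNIV * infsum (F 0) UNIV) + - 8 * (infsum (F 1) UNIV * infsum (F 1) UNIV)
       + - 3 * (infsum (F 0) UNIV * infsum (F 2) UNIV)) UNIV"
    using has_sum_add[OF has_sum_add[OF GS(1,2)] GS(3)] by (simp add: G_def case_prod_unfold)
  moreover have "infsum (F 1) UNIV = 2 * qpoch q q ^ 3"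
    using jacobi_cube[OF q] by (simp add: F_def[abs_def])
  ultimately have G: "(G has_sum (- 32 * qpoch q q ^ 6)) UNIV"
    by (simp flip: power_add power_mult)
  define A where "A k = wtheta k 1 q" for k
  define B where "B k = wtheta k 2 q" for k
  define D where "D = B 2 * A 0 - B 0 * A 2"
  define \<psi> where "\<psi> = (\<lambda>(r, (g, h)). (h + 2 * g + r, 2 * h - g :: int))"
  have bij: "bij_betw \<psi> ({0..<5} \<times> UNIV) UNIV"
    \<comment> \<open>The inverse comes from \<open>i + 2 * j = 5 * h + r\<close>, which determines
      \<open>h\<close> and \<open>r\<close> by division with remainder; then
      \<open>g = 2 * h - j\<close>.\<close>
    by (rule bij_betwI[where g = "\<lambda>(i, j). ((i + 2 * j) mod 5, (2 * ((i + 2 * j) div 5) - j, (i + 2 * j) div 5))"])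
      (auto simp: \<psi>_def, presburger)
  have "((\<lambda>x. G (\<psi> x)) has_sum (- 32 * qpoch q q ^ 6)) ({0..<5} \<times> UNIV)"
    using G has_sum_reindex_bij_betw[OF bij, of G] by blast
  then have total: "(\<Sum>r\<in>{0..<5}. \<Sum>\<^sub>\<infinity>z. G (\<psi> (r, z))) = - 32 * qpoch q q ^ 6"
    using infsum_Sigma_banach[of "\<lambda>x. G (\<psi> x)" "{0..<5}" "\<lambda>_. UNIV"]
    by (metis (no_types, lifting) finite_atLeastLessThan_int has_sum_imp_summable infsumI infsum_finite)
  have cls: "(\<Sum>\<^sub>\<infinity>z. G (\<psi> (r, z))) = (-1) powi r * q powi (tri r + r)
      * (wtheta 2 (2 * r + 3) q * wtheta 0 (r + 4) q - wtheta 0 (2 * r + 3) q * wtheta 2 (r + 4) q)" if "0 \<le> r" for r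
  proof -
    define W where "W k d n = (-1) powi n * real_of_int (10 * n + 2 * d - 5) ^ k * q powi (d * n + 5 * tri n)" for k :: nat and d n :: int
    have W: "abs_summable (W k d)" "infsum (W k d) UNIV = wtheta k d q" if "0 \<le> d" for k d
      unfolding W_def by (rule wtheta_summable[OF q that]) (simp add: wtheta_def)
    \<comment> \<open>Chosen so that \<open>10 * g + 2 * d - 5\<close> and
      \<open>10 * h + 2 * e - 5\<close> are the rotated coordinates \<open>M\<close> and
      \<open>N\<close>.\<close>
    define d e where "d = 2 * r + 3" and "e = r + 4"
    have de: "0 \<le> d" "0 \<le> e" using that by (auto simp: d_def e_def)
    have E: "G (\<psi> (r, z)) = (-1) powi r * q powi (tri r + r) * (W 2 d (fst z) * W 0 e (snd z) - W 0 d (fst z) * W 2 e (snd z))" for z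
    proof -
      obtain g h where z: "z = (g, h)" by (cases z)
      define i j where "i = h + 2 * g + r" and "j = 2 * h - g"
      have "(tri i + i) + (tri j + j) = (tri r + r) + ((d * g + 5 * tri g) + (e * h + 5 * tri h))"
        using two_times_tri[of i] two_times_tri[of j] two_times_tri[of r] two_times_tri[of g] two_times_tri[of h]
        unfolding i_def j_def d_def e_def by (simp add: algebra_simps)
      then have "q powi (tri i + i) * q powi (tri j + j) = q powi (tri r + r) * (q powi (d * g + 5 * tri g) * q powi (e * h + 5 * tri h))"
        using q by (metis less_irrefl power_int_add)
      moreover have "(-1) powi i * (-1) powi j = (-1) powi r * ((-1) powi g * (-1 :: real) powi h)"
      proof -
        have "i + j = r + (g + h) + 2 * h" by (simp add: i_def j_def)
        then have "(-1) powi (i + j) = (-1 :: real) powi (r + (g + h) + 2 * h)" by simp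
        then show ?thesis by (simp add: power_int_add power_int_mult)
      qed
      moreover have "G (i, j) = (3 * real_of_int (2 * i + 1) ^ 2 - 8 * (real_of_int (2 * i + 1) * real_of_int (2 * j + 1)) - 3 * real_of_int (2 * j + 1) ^ 2)
          * ((-1) powi i * (-1) powi j) * (q powi (tri i + i) * q powi (tri j + j))"
        by (simp add: G_def F_def algebra_simps)
      moreover have "3 * real_of_int (2 * i + 1) ^ 2 - 8 * (real_of_int (2 * i + 1) * real_of_int (2 * j + 1)) - 3 * real_of_int (2 * j + 1) ^ 2
          = real_of_int (10 * g + 2 * d - 5) ^ 2 - real_of_int (10 * h + 2 * e - 5) ^ 2"
        by (simp add: i_def j_def d_def e_def power2_eq_square algebra_simps)
      moreover have "\<psi> (r, z) = (i, j)" by (simp add: \<psi>_def z i_def j_def)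
      ultimately have "G (\<psi> (r, z)) = (real_of_int (10 * g + 2 * d - 5) ^ 2 - real_of_int (10 * h + 2 * e - 5) ^ 2)
         * ((-1) powi r * ((-1) powi g * (-1) powi h)) * (q powi (tri r + r) * (q powi (d * g + 5 * tri g) * q powi (e * h + 5 * tri h)))"
        by (simp only:)
      also have "\<dots> = (-1) powi r * q powi (tri r + r) * (W 2 d g * W 0 e h - W 0 d g * W 2 e h)"
        unfolding W_def power_0 mult_1_right right_diff_distrib left_diff_distrib by (simp only: mult_ac)
      finally show ?thesis by (simp add: z)
    qed
    have sW: "(\<lambda>z. W k d (fst z) * W l e (snd z)) summable_on UNIV"
      and pW: "(\<Sum>\<^sub>\<infinity>z. W k d (fst z) * W l e (snd z)) = wtheta k d q * wtheta l e q" for k l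
      using abs_summable_summable[OF abs_summable_times[OF W(1)[OF de(1)] W(1)[OF de(2)]], of k l]
        infsum_times[OF W(1)[OF de(1)] W(1)[OF de(2)], of k l]
      by (simp_all only: W(2)[OF de(1)] W(2)[OF de(2)] case_prod_unfold)
    have "(\<Sum>\<^sub>\<infinity>z. G (\<psi> (r, z))) = (-1) powi r * q powi (tri r + r)
        * (\<Sum>\<^sub>\<infinity>z. W 2 d (fst z) * W 0 e (snd z) - W 0 d (fst z) * W 2 e (snd z))"
      unfolding E by (rule infsum_cmult_right')
    also have "(\<Sum>\<^sub>\<infinity>z. W 2 d (fst z) * W 0 e (snd z) - W 0 d (fst z) * W 2 e (snd z))
        = wtheta 2 d q * wtheta 0 e q - wtheta 0 d q * wtheta 2 e q"
      using infsum_diff[OF sW sW] unfolding pW .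
    finally show ?thesis by (simp only: d_def e_def)
  qed
  have I: "{0..<5 :: int} = {0, 1, 2, 3, 4}" by auto
  have t: "wtheta k 3 q = B k" "wtheta k 4 q = A k" "wtheta k 6 q = - (1 / q) * A k" "wtheta k 7 q = - (1 / q ^ 2) * B k"
      "wtheta k 8 q = - (1 / q ^ 3) * B k" "wtheta k 9 q = - (1 / q ^ 4) * A k" "wtheta k 11 q = (1 / q ^ 7) * A k" if "even k" for k
  proof -
    show 3: "wtheta k 3 q = B k" "wtheta k 4 q = A k"
      using wtheta_reflect[OF that, of 3] wtheta_reflect[OF that, of 4] by (simp_all add: A_def B_def)
    show 6: "wtheta k 6 q = - (1 / q) * A k" "wtheta k 7 q = - (1 / q ^ 2) * B k"
      "wtheta k 8 q = - (1 / q ^ 3) * B k" "wtheta k 9 q = - (1 / q ^ 4) * A k"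
      using wtheta_shift[OF q(1), of k 1] wtheta_shift[OF q(1), of k 2] wtheta_shift[OF q(1), of k 3] wtheta_shift[OF q(1), of k 4] 3
      by (simp_all add: A_def B_def power_int_minus divide_inverse)
    show "wtheta k 11 q = (1 / q ^ 7) * A k"
      using wtheta_shift[OF q(1), of k 6] 6(1) by (simp add: power_int_minus divide_inverse eval_nat_numeral)
  qed
  have tri: "tri 0 = 0" "tri 1 = 0" "tri 2 = 1" "tri 3 = 3" "tri 4 = 6" by (simp_all add: tri_def)
  have ev: "even (0 :: nat)" "even (2 :: nat)" by simp_all
  note tt = t[OF ev(1)] t[OF ev(2)]
  have "(\<Sum>\<^sub>\<infinity>z. G (\<psi> (0, z))) = D"
    using cls[of 0] by (simp add: tri tt D_def)
  \<comment> \<open>For \<open>r = 1\<close> both parameters equal 5, so the antisymmetric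
    difference vanishes. The other four cosets contribute \<open>D\<close> each, which accounts for
    \<open>4 * D\<close> at the end.\<close>
  moreover have "(\<Sum>\<^sub>\<infinity>z. G (\<psi> (1, z))) = 0"
    using cls[of 1] by simp
  moreover have "(\<Sum>\<^sub>\<infinity>z. G (\<psi> (2, z))) = q ^ 3 * (1 / q ^ 2 * B 2 * (1 / q * A 0) - 1 / q ^ 2 * B 0 * (1 / q * A 2))"
    using cls[of 2] by (simp add: tri tt)
  moreover have "\<dots> = D"
    using q by (simp add: D_def field_simps eval_nat_numeral)
  moreover have "(\<Sum>\<^sub>\<infinity>z. G (\<psi> (3, z))) = - (q ^ 6 * (1 / q ^ 4 * A 2 * (1 / q ^ 2 * B 0) - 1 / q ^ 4 * A 0 * (1 / q ^ 2 * B 2)))"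
    using cls[of 3] by (simp add: tri tt)
  moreover have "\<dots> = D"
    using q by (simp add: D_def field_simps eval_nat_numeral)
  moreover have "(\<Sum>\<^sub>\<infinity>z. G (\<psi> (4, z))) = q ^ 10 * (1 / q ^ 7 * A 0 * (1 / q ^ 3 * B 2) - 1 / q ^ 7 * A 2 * (1 / q ^ 3 * B 0))"
    using cls[of 4] by (simp add: tri tt)
  moreover have "\<dots> = D"
    using q by (simp add: D_def field_simps eval_nat_numeral)
  ultimately have "4 * D = - 32 * qpoch q q ^ 6"
    using total by (simp add: I)
  then show ?thesis by (simp add: D_def A_def B_def algebra_simps)
qed

subsection \<open>Derivatives and the substitution\<close>

text \<open>Nonnegative exponents make the derivative terms increase in absolute value with
  \<open>x\<close>, so on the interval up to the midpoint \<open>\<rho>\<close> of \<open>q\<close>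
  and 1 they are dominated by their values at \<open>\<rho>\<close>, and the M-test applies.\<close>

lemma theta_has_derivative:
  fixes q :: real
  assumes q: "0 < q" "q < 1"
    and e: "\<And>n. e n \<ge> 0" "\<And>n. e n \<ge> \<bar>n\<bar> - c" "\<And>n. e n \<le> C * (1 + \<bar>n\<bar>) ^ k"
    and w: "\<And>n. \<bar>w n\<bar> \<le> 1"
  shows "((\<lambda>x. \<Sum>\<^sub>\<infinity>n::int. w n * x powi e n) has_real_derivative (\<Sum>\<^sub>\<infinity>n. w n * real_of_int (e n) * q powi (e n - 1))) (at q)"
proof -
  define \<rho> where "\<rho> = (1 + q) / 2"
  have \<rho>: "0 < \<rho>" "\<rho> < 1" "q < \<rho>" using q by (auto simp: \<rho>_def)
  have sum: "abs_summable (\<lambda>n. w n * x powi e n)" if "0 < x" "x < 1" for x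
    by (rule weighted_theta_abs_summable[OF that e(2), of _ 1 0]) (use w in simp)
  have weight: "\<bar>w n * real_of_int (e n)\<bar> \<le> real_of_int C * real_of_int (1 + \<bar>n\<bar>) ^ k" for n
  proof -
    have "\<bar>w n * real_of_int (e n)\<bar> \<le> 1 * real_of_int (e n)"
      unfolding abs_mult using w[of n] e(1)[of n] by (intro mult_mono) auto
    also have "real_of_int (e n) \<le> real_of_int (C * (1 + \<bar>n\<bar>) ^ k)"
      using e(3)[of n] by (simp only: of_int_le_iff)
    finally show ?thesis by simp
  qed
  have sum': "abs_summable (\<lambda>n. w n * real_of_int (e n) * x powi (e n - 1))" if "0 < x" "x < 1" for x
  proof (rule weighted_theta_abs_summable[OF that _ weight])
    show "\<bar>n\<bar> - (c + 1) \<le> e n - 1" for n using e(2)[of n] by simp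
  qed
  define f where "f j x = w (int_decode j) * x powi e (int_decode j)" for j and x :: real
  define f' where "f' j x = w (int_decode j) * real_of_int (e (int_decode j)) * x powi (e (int_decode j) - 1)" for j and x :: real
  have D: "((\<lambda>x. \<Sum>j. f j x) has_real_derivative (\<Sum>j. f' j q)) (at q)"
  proof (rule has_field_derivative_series'(2))
    show "convex {0<..<\<rho>}" by simp
    show "(f j has_real_derivative f' j x) (at x within {0<..<\<rho>})" if "x \<in> {0<..<\<rho>}" for j x
      unfolding f_def f'_def using that by (auto intro!: derivative_eq_intros simp: mult.assoc)
    show "uniformly_convergent_on {0<..<\<rho>} (\<lambda>n x. \<Sum>j<n. f' j x)"
    proof (rule Weierstrass_m_test')
      show "summable (\<lambda>j. norm (f' j \<rho>))"
        using sum'[OF \<rho>(1,2)] summable_on_int_decode[of "\<lambda>n. norm (w n * real_of_int (e n) * \<rho> powi (e n - 1))"]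
        by (intro summable_on_imp_summable) (simp add: f'_def)
      fix j x assume x: "x \<in> {0<..<\<rho>}"
      define n where "n = int_decode j"
      show "norm (f' j x) \<le> norm (f' j \<rho>)"
      \<comment> \<open>An exponent 0 would leave the decreasing power \<open>x powi (- 1)\<close>,
        but then the factor \<open>e n\<close> makes the term zero.\<close>
      proof (cases "e n = 0")
        case False
        then have "x powi (e n - 1) \<le> \<rho> powi (e n - 1)"
          using e(1)[of n] x by (intro power_int_mono) auto
        then show ?thesis using x \<rho>
          by (auto simp: f'_def n_def[symmetric] abs_mult intro!: mult_left_mono)
      qed (simp add: f'_def n_def)
    qed
    show "summable (\<lambda>j. f j q)"
      using abs_summable_summable[OF sum[OF q]] summable_on_int_decode[of "\<lambda>n. w n * q powi e n"]
      by (intro summable_on_imp_summable) (simp add: f_def)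
    show "q \<in> {0<..<\<rho>}" "q \<in> interior {0<..<\<rho>}" using q \<rho> by (auto simp: interior_open)
  qed
  have "(\<Sum>j. f' j q) = (\<Sum>\<^sub>\<infinity>n. w n * real_of_int (e n) * q powi (e n - 1))"
    using infsum_int_suminf[OF abs_summable_summable[OF sum'[OF q]]] by (simp add: f'_def)
  moreover have "(\<Sum>j. f j x) = (\<Sum>\<^sub>\<infinity>n. w n * x powi e n)" if "x \<in> {0<..<1}" for x
    using infsum_int_suminf[OF abs_summable_summable[OF sum]] that by (simp add: f_def)
  ultimately show ?thesis
    using has_field_derivative_transform_within_open[OF D, of "{0<..<1}"] q by simp
qed

lemma theta_exponent_bounds:
  assumes "0 < c" "c < d"
  shows "c * n + d * tri n \<ge> 0" "c * n + d * tri n \<ge> \<bar>n\<bar> - 0" "c * n + d * tri n \<le> 2 * d * (1 + \<bar>n\<bar>)\<^sup>2"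
proof -
  have t: "2 * tri n = n * (n - 1)" by (rule two_times_tri)
  show "c * n + d * tri n \<ge> \<bar>n\<bar> - 0"
  proof (cases "n \<ge> 1")
    case True
    then have "0 \<le> n * (n - 1)" by simp
    then have "0 \<le> d * tri n" using t assms by simp
    moreover have "n \<le> c * n" using True assms mult_right_mono[of 1 c n] by simp
    ultimately show ?thesis using True by linarith
  next
    case False
    have "n * (n - 1) \<ge> n * (-2)" using False mult_left_mono_neg[of "n - 1" "-2" n] by (cases "n = 0") auto
    then have "tri n \<ge> - n" using t by simp
    then have "d * tri n \<ge> d * - n" using assms by (intro mult_left_mono) auto
    moreover have "(c - d) * n \<ge> (-1) * n" using False assms by (intro mult_right_mono_neg) auto
    ultimately show ?thesis using False by (simp add: algebra_simps)
  qed
  then show "c * n + d * tri n \<ge> 0" by simp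
  have "c * n \<le> d * \<bar>n\<bar>" using assms mult_left_mono[of n "\<bar>n\<bar>" c] mult_right_mono[of c d "\<bar>n\<bar>"] by linarith
  moreover have "tri n \<le> (1 + \<bar>n\<bar>)\<^sup>2"
  proof -
    have "n * n = \<bar>n\<bar> * \<bar>n\<bar>" "0 \<le> \<bar>n\<bar> * \<bar>n\<bar>" "2 * tri n = n * n - n"
      using t by (simp_all add: algebra_simps)
    moreover have "(1 + \<bar>n\<bar>)\<^sup>2 = 1 + 2 * \<bar>n\<bar> + \<bar>n\<bar> * \<bar>n\<bar>" by (simp add: power2_eq_square algebra_simps)
    ultimately show ?thesis by linarith
  qed
  then have "d * tri n \<le> d * (1 + \<bar>n\<bar>)\<^sup>2" using assms by (intro mult_left_mono) auto
  moreover have "d * \<bar>n\<bar> \<le> d * (1 + \<bar>n\<bar>)\<^sup>2"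
    using assms by (intro mult_left_mono) (auto simp: power2_eq_square algebra_simps)
  ultimately show "c * n + d * tri n \<le> 2 * d * (1 + \<bar>n\<bar>)\<^sup>2" by simp
qed

lemma quadratic_theta_has_derivative:
  fixes q :: real
  assumes q: "0 < q" "q < 1" and cd: "0 < c" "c < d"
  shows "((\<lambda>x. \<Sum>\<^sub>\<infinity>n. (-1) powi n * x powi (c * n + d * tri n)) has_real_derivative
           (\<Sum>\<^sub>\<infinity>n. (-1) powi n * real_of_int (c * n + d * tri n) * q powi (c * n + d * tri n - 1))) (at q)"
  by (rule theta_has_derivative[OF q theta_exponent_bounds[OF cd]]) (simp add: power_int_abs)

text \<open>Continuity is read off the pentagonal series, which is differentiable term by term,
  rather than off the product.\<close>

lemma continuous_on_qpoch: "continuous_on {0<..<1} (\<lambda>q::real. qpoch q q)"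
proof -
  have "continuous_on {0<..<1} (\<lambda>x::real. \<Sum>\<^sub>\<infinity>n. (-1) powi n * x powi (1 * n + 3 * tri n))"
    using quadratic_theta_has_derivative[of _ 1 3]
    by (intro continuous_at_imp_continuous_on ballI DERIV_isCont) auto
  then show ?thesis
    by (rule continuous_on_eq) (subst pentagonal_number_theorem, auto)
qed

lemma wtheta_has_derivative:
  fixes q :: real
  assumes q: "0 < q" "q < 1" and d: "0 < d" "d < 5"
  shows "(wtheta 0 d has_real_derivative (wtheta 2 d q - real_of_int ((2 * d - 5)\<^sup>2) * wtheta 0 d q) / (40 * q)) (at q)"
proof -
  define s where "s k n = (-1) powi n * real_of_int (10 * n + 2 * d - 5) ^ k * q powi (d * n + 5 * tri n)" for k :: nat and n
  have s: "s k summable_on UNIV" for k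
    unfolding s_def by (rule abs_summable_summable[OF wtheta_summable[OF q]]) (use d in simp)
  have eq: "(-1) powi n * real_of_int (d * n + 5 * tri n) * q powi (d * n + 5 * tri n - 1)
      = (1 / (40 * q)) * (s 2 n - real_of_int ((2 * d - 5)\<^sup>2) * s 0 n)" for n
  proof -
    have "40 * (d * n + 5 * tri n) = (10 * n + 2 * d - 5)\<^sup>2 - (2 * d - 5)\<^sup>2"
      using two_times_tri[of n] by (simp add: power2_eq_square algebra_simps)
    then have "real_of_int (40 * (d * n + 5 * tri n)) = real_of_int ((10 * n + 2 * d - 5)\<^sup>2 - (2 * d - 5)\<^sup>2)"
      by (rule arg_cong)
    then have X: "real_of_int (d * n + 5 * tri n) = (real_of_int (10 * n + 2 * d - 5) ^ 2 - real_of_int ((2 * d - 5)\<^sup>2)) / 40"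
      unfolding of_int_mult[of 40] of_int_diff[of "_\<^sup>2"] of_int_power[of "10 * n + 2 * d - 5"] by simp
    have Q: "q powi (d * n + 5 * tri n - 1) = q powi (d * n + 5 * tri n) / q"
      using q by (simp add: power_int_diff)
    have "\<sigma> * ((N - c) / 40) * (Q / q) = (1 / (40 * q)) * (\<sigma> * N * Q - c * (\<sigma> * 1 * Q))" for \<sigma> N c Q :: real
      using q by (simp add: field_simps)
    then show ?thesis unfolding s_def X Q power_0 .
  qed
  have w: "wtheta k d q = infsum (s k) UNIV" for k
    unfolding wtheta_def s_def[abs_def] ..
  have "(\<Sum>\<^sub>\<infinity>n. (-1) powi n * real_of_int (d * n + 5 * tri n) * q powi (d * n + 5 * tri n - 1))
      = (1 / (40 * q)) * (\<Sum>\<^sub>\<infinity>n. s 2 n - real_of_int ((2 * d - 5)\<^sup>2) * s 0 n)"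
    unfolding eq by (rule infsum_cmult_right')
  also have "(\<Sum>\<^sub>\<infinity>n. s 2 n - real_of_int ((2 * d - 5)\<^sup>2) * s 0 n)
      = infsum (s 2) UNIV - (\<Sum>\<^sub>\<infinity>n. real_of_int ((2 * d - 5)\<^sup>2) * s 0 n)"
    by (rule infsum_diff[OF s summable_on_cmult_right[OF s]])
  also have "(\<Sum>\<^sub>\<infinity>n. real_of_int ((2 * d - 5)\<^sup>2) * s 0 n) = real_of_int ((2 * d - 5)\<^sup>2) * infsum (s 0) UNIV"
    by (rule infsum_cmult_right')
  finally have D: "(\<Sum>\<^sub>\<infinity>n. (-1) powi n * real_of_int (d * n + 5 * tri n) * q powi (d * n + 5 * tri n - 1))
      = (wtheta 2 d q - real_of_int ((2 * d - 5)\<^sup>2) * wtheta 0 d q) / (40 * q)"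
    unfolding w by simp
  have "wtheta 0 d = (\<lambda>x. \<Sum>\<^sub>\<infinity>n. (-1) powi n * x powi (d * n + 5 * tri n))"
    by (simp only: wtheta_def[abs_def] power_0 mult_1_right)
  then show ?thesis
    using quadratic_theta_has_derivative[OF q d] unfolding D by (simp only:)
qed

text \<open>The fifth power of the continued fraction, free of the root and of the limit, so that it
  can be differentiated as a quotient of theta series.\<close>

definition rr5 :: "real \<Rightarrow> real" where
  "rr5 q = q * (rr_num q / rr_den q) ^ 5"

lemma rr5_pos: "0 < q \<Longrightarrow> q < 1 \<Longrightarrow> rr5 q > 0"
  by (simp add: rr5_def rr_num_pos rr_den_pos)

lemma rr_cfrac_pow5: "0 < q \<Longrightarrow> q < 1 \<Longrightarrow> rr_cfrac q ^ 5 = rr5 q"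
  by (simp add: rr_cfrac_eq rr5_def power_divide power_mult_distrib odd_real_root_pow)

lemma rr_u_eq: "0 < q \<Longrightarrow> q < 1 \<Longrightarrow> rr_u q = 1 / rr5 q - 11 - rr5 q"
  by (simp add: rr_u_def rr_cfrac_pow5)

text \<open>The constants 9 and 1 in the derivatives of the two series leave
  \<open>- 8 * (a * b)\<close> in the quotient rule. After division by 40 and multiplication by 5
  this cancels exactly the contribution of the factor \<open>q\<close>, leaving the Wronskian over
  \<open>a * b = f * g\<close>.\<close>

lemma rr5_has_derivative:
  assumes q: "0 < q" "q < 1"
  shows "(rr5 has_real_derivative rr5 q * (qpoch q q ^ 5 / (q * qpoch (q ^ 5) (q ^ 5)))) (at q)"
proof -
  define a b where "a = rr_num q" and "b = rr_den q"
  define a2 b2 where "a2 = wtheta 2 1 q" and "b2 = wtheta 2 2 q"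
  define f g where "f = qpoch q q" and "g = qpoch (q ^ 5) (q ^ 5)"
  have pos: "a > 0" "b > 0" "f > 0" "g > 0"
    using rr_num_pos[OF q] rr_den_pos[OF q] qpoch_pos[of q q] qpoch_pos[of "q ^ 5" "q ^ 5"] q
    by (simp_all add: a_def b_def f_def g_def power_less_one_iff)
  have ab: "a * b = f * g" using rr_num_times_rr_den[OF q] by (simp add: a_def b_def f_def g_def)
  have W: "b * a2 - a * b2 = 8 * f ^ 6"
    using theta_wronskian[OF q] by (simp add: a_def b_def a2_def b2_def f_def rr_num_wtheta rr_den_wtheta)
  have da: "(rr_num has_real_derivative (a2 - 9 * a) / (40 * q)) (at q)"
    using wtheta_has_derivative[OF q, of 1] by (simp add: a_def a2_def rr_num_wtheta[abs_def])
  have db: "(rr_den has_real_derivative (b2 - b) / (40 * q)) (at q)"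
    using wtheta_has_derivative[OF q, of 2] by (simp add: b_def b2_def rr_den_wtheta[abs_def])
  have dq: "((\<lambda>x. rr_num x / rr_den x) has_real_derivative ((a2 - 9 * a) / (40 * q) * b - a * ((b2 - b) / (40 * q))) / (b * b)) (at q)"
    using DERIV_divide[OF da db] pos by (simp add: a_def b_def)
  have "((a2 - 9 * a) / (40 * q) * b - a * ((b2 - b) / (40 * q))) / (b * b) = ((b * a2 - a * b2) - 8 * (a * b)) / (40 * q * (b * b))"
    using q pos by (simp add: field_simps)
  also have "\<dots> = (f ^ 6 - a * b) / (5 * q * (b * b))"
    unfolding W using q pos by (simp add: field_simps)
  finally have "((\<lambda>x. rr_num x / rr_den x) has_real_derivative (f ^ 6 - a * b) / (5 * q * (b * b))) (at q)"
    using dq by simp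
  from DERIV_mult[OF DERIV_ident DERIV_power[OF this, of 5]]
  have "(rr5 has_real_derivative (a / b) ^ 5 + q * (5 * (a / b) ^ 4 * ((f ^ 6 - a * b) / (5 * q * (b * b))))) (at q)"
    unfolding rr5_def[abs_def] by (simp add: a_def b_def algebra_simps)
  moreover have "(a / b) ^ 5 + q * (5 * (a / b) ^ 4 * ((f ^ 6 - a * b) / (5 * q * (b * b)))) = (a / b) ^ 4 * f ^ 6 / (b * b)"
    using q pos by (simp add: field_simps eval_nat_numeral)
  moreover have "(a / b) ^ 4 * f ^ 6 / (b * b) = q * (a / b) ^ 5 * (f ^ 5 / (q * g))"
  proof -
    have "(a / b) ^ 4 * f ^ 6 / (b * b) = (a / b) ^ 5 * (f ^ 6 / (a * b))"
      using pos by (simp add: field_simps eval_nat_numeral)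
    also have "f ^ 6 / (a * b) = f ^ 5 / g" unfolding ab using pos by (simp add: field_simps eval_nat_numeral)
    finally show ?thesis using q by simp
  qed
  ultimately show ?thesis by (simp add: rr5_def a_def b_def f_def g_def)
qed

lemma rr_u_quotient:
  assumes q: "0 < q" "q < 1"
  shows "rr_u q = (qpoch q q / qpoch (q ^ 5) (q ^ 5)) ^ 6 / q"
proof -
  define \<rho> where "\<rho> = rr_num q / rr_den q"
  have \<rho>: "\<rho> > 0" using rr_num_pos[OF q] rr_den_pos[OF q] by (simp add: \<rho>_def)
  have g: "qpoch (q ^ 5) (q ^ 5) > 0"
    using q by (intro qpoch_pos) (simp_all add: power_less_one_iff)
  have "(qpoch q q / qpoch (q ^ 5) (q ^ 5)) ^ 6 = (1 / \<rho>) ^ 5 - 11 * q - q\<^sup>2 * \<rho> ^ 5"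
    unfolding power_divide[of "qpoch q q"] rr_quotient_identity[OF q] \<rho>_def[symmetric] using g by simp
  also have "\<dots> / q = 1 / (q * \<rho> ^ 5) - 11 - q * \<rho> ^ 5"
    using q \<rho> by (simp add: field_simps power2_eq_square)
  finally show ?thesis
    by (simp add: rr_u_eq[OF q] rr5_def \<rho>_def)
qed

lemma rr_u_pos:
  assumes q: "0 < q" "q < 1"
  shows "rr_u q > 0"
  unfolding rr_u_quotient[OF q] using q
  by (intro divide_pos_pos zero_less_power qpoch_pos) (simp_all add: power_less_one_iff)

lemma sqrt_rr_u:
  assumes q: "0 < q" "q < 1"
  shows "sqrt (125 + 22 * rr_u q + (rr_u q)\<^sup>2) = 1 / rr5 q + rr5 q"
proof -
  have r: "rr5 q > 0" by (rule rr5_pos[OF q])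
  have "125 + 22 * rr_u q + (rr_u q)\<^sup>2 = (1 / rr5 q + rr5 q)\<^sup>2"
    unfolding rr_u_eq[OF q] using r by (simp add: power2_eq_square field_simps)
  then show ?thesis using r by simp
qed

text \<open>The derivative in closed form: the logarithmic derivative of \<open>rr5\<close> times
  \<open>- (1 / rr5 q + rr5 q)\<close>. The substitution rule needs it as an explicitly continuous
  function.\<close>

definition rr_u' :: "real \<Rightarrow> real" where
  "rr_u' q = - ((1 / rr5 q + rr5 q) * (qpoch q q ^ 5 / (q * qpoch (q ^ 5) (q ^ 5))))"

lemma rr_u_has_derivative:
  assumes q: "0 < q" "q < 1"
  shows "(rr_u has_real_derivative rr_u' q) (at q)"
proof -
  have r: "rr5 q > 0" by (rule rr5_pos[OF q])
  define X where "X = qpoch q q ^ 5 / (q * qpoch (q ^ 5) (q ^ 5))"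
  have D: "(rr5 has_real_derivative rr5 q * X) (at q)"
    unfolding X_def by (rule rr5_has_derivative[OF q])
  have "((\<lambda>x. inverse (rr5 x) - 11 - rr5 x) has_real_derivative
      - (inverse (rr5 q) * (rr5 q * X) * inverse (rr5 q)) - 0 - rr5 q * X) (at q)"
    by (intro DERIV_diff DERIV_inverse' DERIV_const D) (use r in simp)
  moreover have "- (inverse (rr5 q) * (rr5 q * X) * inverse (rr5 q)) - 0 - rr5 q * X = rr_u' q"
    unfolding rr_u'_def X_def[symmetric] using r by (simp add: field_simps)
  ultimately have "((\<lambda>x. 1 / rr5 x - 11 - rr5 x) has_real_derivative rr_u' q) (at q)"
    by (simp add: inverse_eq_divide)
  then show ?thesis
    by (rule has_field_derivative_transform_within_open[of _ _ _ "{0<..<1}"]) (use q rr_u_eq in auto)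
qed

lemma continuous_on_rr_u': "continuous_on {0<..<1} rr_u'"
proof -
  have "continuous_on {0<..<1} rr5"
    using rr5_has_derivative by (intro continuous_at_imp_continuous_on ballI DERIV_isCont) auto
  moreover have "continuous_on {0<..<1} (\<lambda>q::real. qpoch (q ^ 5) (q ^ 5))"
    by (rule continuous_on_compose2[OF continuous_on_qpoch, of _ "\<lambda>q. q ^ 5"])
      (auto intro!: continuous_intros simp: power_less_one_iff)
  moreover have "qpoch (q ^ 5) (q ^ 5) \<noteq> 0" if "q \<in> {0<..<1}" for q :: real
    using qpoch_self_nonzero[of "q ^ 5"] that by (simp add: power_less_one_iff)
  moreover have "rr5 q \<noteq> 0" if "q \<in> {0<..<1}" for q
    using rr5_pos[of q] that by auto
  ultimately show ?thesis
    unfolding rr_u'_def[abs_def] by (intro continuous_intros continuous_on_qpoch) auto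
qed

text \<open>With \<open>y = g / f\<close>, \<open>rr_u q\<close> is
  \<open>y powr (- 6) * q powr (- 1)\<close> and the factor in \<open>rr_u'\<close> is
  \<open>y powr (- 1) * q powr (- 1) * f ^ 4\<close>. The exponents add up to
  \<open>- 6 * (k - 1) - 1 = - 6 * k + 5\<close> and \<open>- (k - 1) - 1 = - k\<close>, and the
  square root cancels the remaining factor of \<open>rr_u'\<close>.\<close>

lemma integrand_substitution:
  assumes q: "0 < q" "q < 1"
  shows "(ramanujan_f (- (q ^ 5)) / ramanujan_f (- q)) powr (- 6 * k + 5) * ramanujan_f (- q) ^ 4 * q powr (- k)
    = - (rr_u' q *\<^sub>R (rr_u q powr (k - 1) / sqrt (125 + 22 * rr_u q + (rr_u q)\<^sup>2)))"
proof -
  define f g y where "f = qpoch q q" and "g = qpoch (q ^ 5) (q ^ 5)" and "y = g / f"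
  have pos: "f > 0" "g > 0"
    using qpoch_pos[of q q] qpoch_pos[of "q ^ 5" "q ^ 5"] q by (simp_all add: f_def g_def power_less_one_iff)
  then have y: "y > 0" by (simp add: y_def)
  have y6: "y powr (- 6) = (f / g) ^ 6"
    using y pos unfolding powr_minus by (simp add: y_def power_divide)
  have y1: "y powr (- 1) = f / g"
    using y pos unfolding powr_minus by (simp add: y_def)
  have q1: "q powr (- 1) = 1 / q"
    using q unfolding powr_minus by (simp add: inverse_eq_divide)
  have "rr_u q = y powr (- 6) * q powr (- 1)"
    unfolding y6 q1 rr_u_quotient[OF q] f_def g_def by simp
  then have "rr_u q powr (k - 1) = y powr (- 6 * (k - 1)) * q powr (- (k - 1))"
    by (simp only: powr_mult powr_ge_zero powr_powr mult_minus1)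
  moreover have "f ^ 5 / (q * g) = y powr (- 1) * q powr (- 1) * f ^ 4"
    unfolding y1 q1 by (simp add: eval_nat_numeral)
  ultimately have "rr_u q powr (k - 1) * (f ^ 5 / (q * g)) =
      (y powr (- 6 * (k - 1)) * y powr (- 1)) * (q powr (- (k - 1)) * q powr (- 1)) * f ^ 4"
    by (simp only: mult_ac)
  also have "\<dots> = y powr (- 6 * k + 5) * f ^ 4 * q powr (- k)"
    unfolding powr_add[symmetric] by (simp add: algebra_simps)
  finally have "rr_u q powr (k - 1) * (f ^ 5 / (q * g)) = y powr (- 6 * k + 5) * f ^ 4 * q powr (- k)" .
  moreover have "1 / rr5 q + rr5 q \<noteq> 0"
    using rr5_pos[OF q] by (intro less_imp_neq[symmetric] add_pos_pos) auto
  then have "- (- ((1 / rr5 q + rr5 q) * Y) * (U / (1 / rr5 q + rr5 q))) = U * Y" for U Y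
    by simp
  ultimately show ?thesis
    unfolding sqrt_rr_u[OF q] rr_u'_def ramanujan_f_minus f_def[symmetric] g_def[symmetric] y_def[symmetric] real_scaleR_def
    by (simp only:)
qed

theorem theorem2:
  fixes k a b :: real
  assumes "0 < a" "a < 1" "0 < b" "b < 1"
  shows "(LBINT q=a..b. (ramanujan_f (- (q ^ 5)) / ramanujan_f (- q)) powr (- 6 * k + 5)
            * ramanujan_f (- q) ^ 4 * q powr (- k))
       = - (LBINT x=rr_u a..rr_u b. x powr (k - 1) / sqrt (125 + 22 * x + x ^ 2))"
proof -
  define I where "I q = (ramanujan_f (- (q ^ 5)) / ramanujan_f (- q)) powr (- 6 * k + 5)
            * ramanujan_f (- q) ^ 4 * q powr (- k)" for q
  define F where "F x = x powr (k - 1) / sqrt (125 + 22 * x + x ^ 2)" for x :: real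
  \<comment> \<open>The substitution rule wants ordered endpoints only on the side of
    \<open>q\<close>. The image integral is oriented, so no monotonicity of \<open>rr_u\<close> is
    involved; for \<open>b < a\<close> both integrals change sign together.\<close>
  have le: "(LBINT q=a..b. I q) = - (LBINT x=rr_u a..rr_u b. F x)"
    if ab: "0 < a" "a \<le> b" "b < 1" for a b
  proof -
    have "(LBINT q=a..b. I q) = (LBINT q=a..b. - (rr_u' q *\<^sub>R F (rr_u q)))"
      by (rule interval_integral_cong)
        (use ab integrand_substitution in \<open>auto simp: I_def F_def einterval_def min_def max_def split: if_splits\<close>)
    also have "\<dots> = - (LBINT q=a..b. rr_u' q *\<^sub>R F (rr_u q))"
      by (rule interval_lebesgue_integral_uminus)
    also have "(LBINT q=a..b. rr_u' q *\<^sub>R F (rr_u q)) = (LBINT x=rr_u a..rr_u b. F x)"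
    proof (rule interval_integral_substitution_finite[OF ab(2)])
      show "(rr_u has_real_derivative rr_u' q) (at q within {a..b})" if "a \<le> q" "q \<le> b" for q
        using rr_u_has_derivative[of q] that ab has_field_derivative_at_within by auto
      have "rr_u y > 0" if "a \<le> y" "y \<le> b" for y
        using that ab by (intro rr_u_pos) auto
      moreover from this have "125 + 22 * rr_u y + (rr_u y)\<^sup>2 > 0" if "a \<le> y" "y \<le> b" for y
        using that by (intro add_pos_nonneg) (auto intro: less_imp_le)
      ultimately have "rr_u y \<noteq> 0 \<and> 125 + 22 * rr_u y + (rr_u y)\<^sup>2 \<noteq> 0" if "a \<le> y" "y \<le> b" for y
        using that by (metis less_irrefl)
      then show "continuous_on (rr_u ` {a..b}) F"
        unfolding F_def by (intro continuous_intros) auto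
      show "continuous_on {a..b} rr_u'"
        by (rule continuous_on_subset[OF continuous_on_rr_u']) (use ab in auto)
    qed
    finally show ?thesis .
  qed
  have "(LBINT q=a..b. I q) = - (LBINT x=rr_u a..rr_u b. F x)"
  proof (cases "a \<le> b")
    case True
    then show ?thesis using le assms by auto
  next
    case False
    then show ?thesis
      using le[of b a] assms interval_integral_endpoints_reverse[of "ereal a" "ereal b" I]
        interval_integral_endpoints_reverse[of "ereal (rr_u a)" "ereal (rr_u b)" F] by auto
  qed
  then show ?thesis by (simp add: I_def F_def)
qed

end
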